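(* Let $L_1=\langle1,1,16\rangle$, $L_2=\langle1,4,16\rangle$, $L_3=\langle1,8,64\rangle$, $L_4=\langle1,16,16\rangle$. For any integer $k=2^a(8t+\alpha)$ with integers $a,t\ge0$ and $\alpha\in\{1,3,5,7\}$: $$r(k,L_1)=\begin{cases}\tfrac13\mathfrak{r}_1(k)+\delta_\square(k)(-1)^{\frac{\sqrt k-1}{2}}\cdot 2\sqrt k & \text{if }(a,\alpha)=(0,1),\\ c_1(a,\alpha)\mathfrak{r}_1(k)&\text{otherwise},\end{cases}$$ $$r(k,L_2)=\begin{cases}\tfrac16\mathfrak{r}_1(k)+\delta_\square(k)(-1)^{\frac{\sqrt k-1}{2}}\sqrt k & \text{if }(a,\alpha)=(0,1),\\ c_2(a,\alpha)\mathfrak{r}_1(k)&\text{otherwise},\end{cases}$$ $$r(k,L_3)=\begin{cases}\tfrac14\mathfrak{r}_2(k)+\delta_\square(k)(-1)^{\frac{\sqrt k-1}{2}}(-1)^{\frac18(k-1)}\sqrt k & \text{if }(a,\alpha)=(0,1),\\ c_3(a,\alpha)\mathfrak{r}_2(k)&\text{otherwise},\end{cases}$$ $$r(k,L_4)=\begin{cases}\tfrac16\mathfrak{r}_1(k)+\delta_\square(k)(-1)^{\frac{\sqrt k-1}{2}}\sqrt k & \text{if }(a,\alpha)=(0,1),\\ c_4(a,\alpha)\mathfrak{r}_1(k)&\text{otherwise}.\end{cases}$$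
   Context: $\langle a_1,a_2,a_3\rangle$ is the diagonal form $a_1x^2+a_2y^2+a_3z^2$; for a form $f$, $r(k,f)=|\{\mathbf{x}\in\mathbb{Z}^3: f(\mathbf{x})=k\}|$. $\mathfrak{r}_1(k)=r(k,\langle1,1,1\rangle)$, $\mathfrak{r}_2(k)=r(k,\langle1,1,2\rangle)$. $\delta_\square(k)=1$ if $k$ is the square of an integer and $0$ otherwise (when $\delta_\square(k)=1$, $\sqrt k$ denotes the positive square root). The constants $c_i(a,\alpha)$ are defined as follows (where "$(a',\ast)$" means all $\alpha\in\{1,3,5,7\}$, and all unlisted pairs give $0$): - $c_1$: $\tfrac13$ for $(0,1),(0,5),(1,1),(1,5)$; $\tfrac23$ for $(2,1),(2,5)$; $\tfrac13$ for $(3,\ast)$; $1$ for $a\ge4$. - $c_2$: $\tfrac16$ for $(0,1),(0,5)$; $\tfrac23$ for $(2,1),(2,5)$; $\tfrac13$ for $(3,\ast)$; $1$ for $a\ge4$. - $c_3$: $\tfrac14$ for $(0,1)$; $\tfrac16$ for $(2,1),(2,3)$; $\tfrac13$ for $(3,1)$; $\tfrac12$ for $(3,3)$; $\tfrac16$ for $(4,\ast)$; $\tfrac13$ for $(5,1)$; $1$ for $(5,3)$; $\tfrac13$ for $(5,5)$; $\tfrac13$ for $(6,\ast)$; $1$ for $a\ge7$. - $c_4$: $\tfrac16$ for $(0,1)$; $\tfrac13$ for $(2,1),(2,5)$; $1$ for $a\ge4$. *)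

theory Defs
  imports Complex_Main
begin

definition diag_form :: "int \<Rightarrow> int \<Rightarrow> int \<Rightarrow> int \<times> int \<times> int \<Rightarrow> int" where
  "diag_form a1 a2 a3 = (\<lambda>(x, y, z). a1 * x^2 + a2 * y^2 + a3 * z^2)"

text \<open>The forms below are positive definite, so the solution sets are finite and \<open>card\<close> is
  the true number of representations.\<close>

definition num_reps :: "int \<Rightarrow> (int \<times> int \<times> int \<Rightarrow> int) \<Rightarrow> nat" where
  "num_reps k f = card {v. f v = k}"

definition L1 :: "int \<times> int \<times> int \<Rightarrow> int" where "L1 = diag_form 1 1 16"
definition L2 :: "int \<times> int \<times> int \<Rightarrow> int" where "L2 = diag_form 1 4 16"
definition L3 :: "int \<times> int \<times> int \<Rightarrow> int" where "L3 = diag_form 1 8 64"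
definition L4 :: "int \<times> int \<times> int \<Rightarrow> int" where "L4 = diag_form 1 16 16"

definition rr1 :: "int \<Rightarrow> nat" where "rr1 k = num_reps k (diag_form 1 1 1)"
definition rr2 :: "int \<Rightarrow> nat" where "rr2 k = num_reps k (diag_form 1 1 2)"

definition delta_square :: "int \<Rightarrow> real" where
  "delta_square k = (if \<exists>n::int. k = n^2 then 1 else 0)"

text \<open>The sign \<open>(-1)\<close> to the power \<open>(\<surd>k - 1) / 2\<close>. It is used only as a cofactor of
  \<^term>\<open>delta_square k\<close> with \<open>k \<equiv> 1 (mod 8)\<close>; whenever that factor is nonzero, \<open>\<surd>k\<close> is an odd
  positive integer, so the exponent is an integer and the floor has no effect.\<close>

definition sqrt_sign :: "int \<Rightarrow> real" where
  "sqrt_sign k = (-1) powi \<lfloor>(sqrt (real_of_int k) - 1) / 2\<rfloor>"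

text \<open>The constants \<open>c\<^sub>i(a, \<alpha>)\<close> are meaningful for \<open>\<alpha> \<in> {1, 3, 5, 7}\<close> only; clauses that do not
  mention \<open>\<alpha>\<close> apply to all four values.\<close>

definition c1 :: "nat \<Rightarrow> nat \<Rightarrow> real" where
  "c1 a \<alpha> =
    (if (a, \<alpha>) \<in> {(0, 1), (0, 5), (1, 1), (1, 5)} then 1/3
     else if (a, \<alpha>) \<in> {(2, 1), (2, 5)} then 2/3
     else if a = 3 then 1/3
     else if a \<ge> 4 then 1
     else 0)"

definition c2 :: "nat \<Rightarrow> nat \<Rightarrow> real" where
  "c2 a \<alpha> =
    (if (a, \<alpha>) \<in> {(0, 1), (0, 5)} then 1/6
     else if (a, \<alpha>) \<in> {(2, 1), (2, 5)} then 2/3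
     else if a = 3 then 1/3
     else if a \<ge> 4 then 1
     else 0)"

definition c3 :: "nat \<Rightarrow> nat \<Rightarrow> real" where
  "c3 a \<alpha> =
    (if (a, \<alpha>) = (0, 1) then 1/4
     else if (a, \<alpha>) \<in> {(2, 1), (2, 3)} then 1/6
     else if (a, \<alpha>) = (3, 1) then 1/3
     else if (a, \<alpha>) = (3, 3) then 1/2
     else if a = 4 then 1/6
     else if (a, \<alpha>) = (5, 1) then 1/3
     else if (a, \<alpha>) = (5, 3) then 1
     else if (a, \<alpha>) = (5, 5) then 1/3
     else if a = 6 then 1/3
     else if a \<ge> 7 then 1
     else 0)"

definition c4 :: "nat \<Rightarrow> nat \<Rightarrow> real" where
  "c4 a \<alpha> =
    (if (a, \<alpha>) = (0, 1) then 1/6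
     else if (a, \<alpha>) \<in> {(2, 1), (2, 5)} then 1/3
     else if a \<ge> 4 then 1
     else 0)"

end

theory Submission
  imports Defs "HOL-Computational_Algebra.Formal_Power_Series"
begin

text \<open>Outside the case \<open>k \<equiv> 1 (mod 8)\<close>, every identity is a comparison of residue classes of the
  coordinates: the forms count the representations by \<open>\<langle>1,1,1\<rangle>\<close> or \<open>\<langle>1,1,2\<rangle>\<close> whose coordinates satisfy
  divisibility conditions, and permuting coordinates gives the proportions. The linear changes
  \<open>(x, y) \<mapsto> (x + y, x - y)\<close> relate \<open>\<langle>1,1,2\<rangle>\<close> to \<open>\<langle>1,1,1\<rangle>\<close>.

  For \<open>k \<equiv> 1 (mod 8)\<close> the identities amount to Jacobi's formula
  \<open>\<Sum> \<chi>(n) n q^{n\<^sup>2} = (\<Sum> q^{x\<^sup>2}) (\<Sum> (-1)^u q^{8u\<^sup>2})\<^sup>2\<close> (\<open>n\<close>, \<open>x\<close> odd), that is, \<open>\<psi>(Q) \<phi>(-Q)\<^sup>2 = \<Prod> (1 - Q^n)\<^sup>3\<close> with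
  \<open>Q = q\<^sup>8\<close>. No infinite product is needed: the substitution \<open>n = a + 2v\<close>, \<open>m = a - 2v\<close> in the double
  sums expresses both the product of \<open>T = \<Sum> \<chi>(n) n q^{n\<^sup>2}\<close> and \<open>P = \<Sum> q^{x\<^sup>2}\<close> and their Wronskian
  through a third series, which cancels; so both sides of Jacobi's formula have the same
  logarithmic derivative.\<close>

section \<open>Generating series of weighted representation numbers\<close>

text \<open>The formal series of w(x) q^Q(x) over x in A. An infinite fibre would contribute the
  default sum 0; \<open>graded\<close> excludes such fibres.\<close>

definition gen_series :: "'a set \<Rightarrow> ('a \<Rightarrow> int) \<Rightarrow> ('a \<Rightarrow> int) \<Rightarrow> int fps" where
  "gen_series A Q w = Abs_fps (\<lambda>n. \<Sum>x | x \<in> A \<and> Q x = int n. w x)"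

text \<open>Finiteness is asked of sublevel sets, because a sublevel set of a sum of two nonnegative
  functions lies in the product of theirs.\<close>

definition graded :: "('a \<Rightarrow> int) \<Rightarrow> bool" where
  "graded Q \<longleftrightarrow> (\<forall>x. Q x \<ge> 0) \<and> (\<forall>n. finite {x. Q x \<le> n})"

lemma gen_series_nth: "fps_nth (gen_series A Q w) n = (\<Sum>x | x \<in> A \<and> Q x = int n. w x)"
  by (simp add: gen_series_def)

lemma abs_le_of_mult_square_le:
  fixes c x n :: int
  assumes "c > 0" "c * x\<^sup>2 \<le> n"
  shows "\<bar>x\<bar> \<le> n"
proof -
  have "\<bar>x\<bar> \<le> x\<^sup>2"
    by (metis abs_ge_zero linorder_not_le nle_le power2_abs self_le_power pos2 abs_0 power_zero_numeral int_one_le_iff_zero_less)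
  also have "\<dots> \<le> c * x\<^sup>2" using assms(1) by (simp add: mult_le_cancel_right1)
  finally show ?thesis using assms(2) by simp
qed

lemma graded_square: "c > 0 \<Longrightarrow> graded (\<lambda>x::int. c * x\<^sup>2)"
  unfolding graded_def
proof (intro conjI allI)
  fix n assume c: "c > 0"
  show "finite {x. c * x\<^sup>2 \<le> n}"
    by (rule finite_subset[of _ "{-n..n}"]) (use abs_le_of_mult_square_le[OF c] in \<open>force simp: abs_le_iff\<close>, simp)
qed simp

lemma graded_square1: "graded (\<lambda>x::int. x\<^sup>2)"
  using graded_square[of 1] by simp

lemma graded_finite: "graded Q \<Longrightarrow> finite {x. x \<in> A \<and> Q x = n}"
  unfolding graded_def by (metis (mono_tags, lifting) finite_subset mem_Collect_eq order_refl subsetI)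

lemma graded_prod:
  assumes "graded Q" "graded R"
  shows "graded (\<lambda>(x, y). Q x + R y)"
  unfolding graded_def
proof (intro conjI allI)
  fix n
  have "{x. (case x of (x, y) \<Rightarrow> Q x + R y) \<le> n} \<subseteq> {x. Q x \<le> n} \<times> {x. R x \<le> n}"
    using assms unfolding graded_def by (auto intro: order_trans[rotated] simp: add_increasing add_increasing2)
  thus "finite {x. (case x of (x, y) \<Rightarrow> Q x + R y) \<le> n}"
    using assms unfolding graded_def by (meson finite_SigmaI finite_subset)
qed (use assms in \<open>auto simp: graded_def\<close>)

text \<open>The Cauchy product: the fibre of the summed exponent over n is the disjoint union of
  products of fibres over i and n - i.\<close>

lemma gen_series_mult:
  assumes "graded Q" "graded R"
  shows "gen_series A Q v * gen_series B R w
    = gen_series (A \<times> B) (\<lambda>(x, y). Q x + R y) (\<lambda>(x, y). v x * w y)"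
proof (rule fps_ext)
  fix n
  let ?S = "\<lambda>i. {x. x \<in> A \<and> Q x = int i} \<times> {y. y \<in> B \<and> R y = int (n - i)}"
  have *: "{p. p \<in> A \<times> B \<and> (case p of (x, y) \<Rightarrow> Q x + R y) = int n} = (\<Union>i\<in>{0..n}. ?S i)"
  proof (intro equalityI subsetI)
    fix p assume p: "p \<in> {p. p \<in> A \<times> B \<and> (case p of (x, y) \<Rightarrow> Q x + R y) = int n}"
    obtain x y where xy: "p = (x, y)" by (cases p)
    have "Q x \<ge> 0" "R y \<ge> 0" using assms by (auto simp: graded_def)
    then show "p \<in> (\<Union>i\<in>{0..n}. ?S i)"
      using p xy by (auto intro!: bexI[of _ "nat (Q x)"] simp: of_nat_diff)
  qed (auto simp: of_nat_diff)
  have "(\<Sum>p\<in>(\<Union>i\<in>{0..n}. ?S i). case p of (x, y) \<Rightarrow> v x * w y)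
      = (\<Sum>i=0..n. \<Sum>p\<in>?S i. case p of (x, y) \<Rightarrow> v x * w y)"
    by (rule sum.UNION_disjoint) (auto intro!: graded_finite assms)
  also have "\<dots> = (\<Sum>i=0..n. fps_nth (gen_series A Q v) i * fps_nth (gen_series B R w) (n - i))"
    by (simp add: gen_series_nth sum_product sum.cartesian_product)
  finally show "fps_nth (gen_series A Q v * gen_series B R w) n = fps_nth (gen_series (A \<times> B) (\<lambda>(x, y). Q x + R y) (\<lambda>(x, y). v x * w y)) n"
    by (simp add: gen_series_nth[of "A \<times> B"] * fps_mult_nth)
qed

text \<open>The operator q d/dq multiplies the coefficient of q^n by n, and n is the value of
  \<open>Q\<close> on the whole fibre.\<close>

lemma gen_series_XD:
  "fps_XD (gen_series A Q w) = gen_series A Q (\<lambda>x. Q x * w x)"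
proof (rule fps_ext)
  fix n show "fps_nth (fps_XD (gen_series A Q w)) n = fps_nth (gen_series A Q (\<lambda>x. Q x * w x)) n"
    by (cases n) (auto simp: gen_series_nth sum_distrib_left intro!: sum.cong)
qed

lemma gen_series_cong:
  "(\<And>x. x \<in> A \<Longrightarrow> Q x = R x) \<Longrightarrow> (\<And>x. x \<in> A \<Longrightarrow> v x = w x) \<Longrightarrow> gen_series A Q v = gen_series A R w"
  by (rule fps_ext) (auto simp: gen_series_nth intro!: sum.cong)

lemma gen_series_diff:
  "gen_series A Q v - gen_series A Q w = gen_series A Q (\<lambda>x. v x - w x)"
  by (rule fps_ext) (simp add: gen_series_nth sum_subtractf)

lemma gen_series_const:
  "of_int c * gen_series A Q v = gen_series A Q (\<lambda>x. c * v x)"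
  by (rule fps_ext) (simp add: gen_series_nth sum_distrib_left fps_of_int fps_mult_left_const_nth)

section \<open>Sign characters and pairs of odd squares\<close>

abbreviation odds :: "int set" where "odds \<equiv> {n. odd n}"

text \<open>\<open>chi4\<close> and \<open>chi8\<close> are the characters \<open>(-1/n)\<close> and \<open>(2/n)\<close> at odd arguments only; at even
  arguments they take junk values.\<close>

definition alt :: "int \<Rightarrow> int" where "alt u = (if even u then 1 else - 1)"
definition chi4 :: "int \<Rightarrow> int" where "chi4 n = (if n mod 4 = 1 then 1 else - 1)"
definition chi8 :: "int \<Rightarrow> int" where "chi8 n = (if n mod 8 \<in> {1, 7} then 1 else - 1)"

lemma odd_mod_4: "odd (n::int) \<longleftrightarrow> n mod 4 = 1 \<or> n mod 4 = 3" by presburger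
lemma odd_mod_8: "odd (n::int) \<longleftrightarrow> n mod 8 = 1 \<or> n mod 8 = 3 \<or> n mod 8 = 5 \<or> n mod 8 = 7" by presburger

text \<open>Up to the sign of \<open>m\<close>, a pair of odd integers satisfies \<open>n \<equiv> m (mod 4)\<close>, that is,
  \<open>n = a + 2v\<close> and \<open>m = a - 2v\<close> with \<open>a\<close> odd; \<open>w'\<close> also symmetrises over the sign of \<open>v\<close>.\<close>

lemma gen_series_odd_pairs:
  fixes w :: "int \<times> int \<Rightarrow> int"
  assumes sym: "\<And>n m. odd n \<Longrightarrow> odd m \<Longrightarrow> w (n, - m) = w (n, m)"
    and w': "\<And>a v. odd a \<Longrightarrow> w (a + 2 * v, a - 2 * v) + w (a - 2 * v, a + 2 * v) = w' (a, v)"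
  shows "gen_series (odds \<times> odds) (\<lambda>(n, m). n\<^sup>2 + m\<^sup>2) w
       = gen_series (odds \<times> UNIV) (\<lambda>(a, v). 2 * a\<^sup>2 + 8 * v\<^sup>2) w'"
proof (rule fps_ext)
  fix N :: nat
  define S where "S = {p. p \<in> odds \<times> odds \<and> (case p of (n, m) \<Rightarrow> n\<^sup>2 + m\<^sup>2) = int N}"
  define S1 where "S1 = {p \<in> S. 4 dvd (fst p - snd p)}"
  define S2 where "S2 = {p \<in> S. 4 dvd (fst p + snd p)}"
  define R where "R = {p. p \<in> odds \<times> UNIV \<and> (case p of (a, v) \<Rightarrow> 2 * a\<^sup>2 + 8 * v\<^sup>2) = int N}"
  have "finite S" unfolding S_def
    by (rule graded_finite[OF graded_prod[OF graded_square1 graded_square1]])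
  \<comment> \<open>For odd n and m exactly one of n - m and n + m is divisible by 4. The sign
    change of m exchanges the two classes and preserves w.\<close>
  moreover have "S = S1 \<union> S2" "S1 \<inter> S2 = {}" 
    unfolding S1_def S2_def S_def by (auto) presburger+
  ultimately have "sum w S = sum w S1 + sum w S2"
    using sum.union_disjoint[of S1 S2 w] by (simp add: finite_Un)
  moreover have "sum w S2 = sum w S1"
    by (rule sum.reindex_bij_witness[where i = "\<lambda>(n, m). (n, - m)" and j = "\<lambda>(n, m). (n, - m)"])
       (auto simp: S1_def S2_def S_def sym)
  moreover have S1R: "sum w S1 = (\<Sum>(a, v)\<in>R. w (a + 2 * v, a - 2 * v))"
  proof (rule sum.reindex_bij_witness[where j = "\<lambda>(n, m). ((n + m) div 2, (n - m) div 4)" and i = "\<lambda>(a, v). (a + 2 * v, a - 2 * v)"]; clarsimp simp: S1_def S_def R_def)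
    fix n m :: int
    assume h: "4 dvd n - m" "odd n" "odd m" "n\<^sup>2 + m\<^sup>2 = int N"
    from h obtain v where v: "n - m = 4 * v" by (auto elim: dvdE)
    define a where "a = m + 2 * v"
    have nm: "n = a + 2 * v" "m = a - 2 * v" using v by (auto simp: a_def)
    have "odd a" using nm h by presburger
    then show "(n + m) div 2 + 2 * ((n - m) div 4) = n \<and> (n + m) div 2 - 2 * ((n - m) div 4) = m" 
      "odd ((n + m) div 2) \<and> 2 * ((n + m) div 2)\<^sup>2 + 8 * ((n - m) div 4)\<^sup>2 = int N"
      "w ((n + m) div 2 + 2 * ((n - m) div 4), (n + m) div 2 - 2 * ((n - m) div 4)) = w (n, m)"
      using h(4) unfolding nm by (simp_all add: power2_eq_square algebra_simps)
  qed (auto simp: power2_eq_square algebra_simps)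
  moreover have "(\<Sum>(a, v)\<in>R. w (a + 2 * v, a - 2 * v)) = (\<Sum>(a, v)\<in>R. w (a - 2 * v, a + 2 * v))"
    by (rule sum.reindex_bij_witness[where i = "\<lambda>(a, v). (a, - v)" and j = "\<lambda>(a, v). (a, - v)"])
       (auto simp: R_def)
  \<comment> \<open>Of the two equal halves, one is written with v and the other with -v; together
    they give the symmetrised weight.\<close>
  ultimately have "sum w S = (\<Sum>(a, v)\<in>R. w (a + 2 * v, a - 2 * v)) + (\<Sum>(a, v)\<in>R. w (a - 2 * v, a + 2 * v))"
    by simp
  also have "\<dots> = sum w' R"
    unfolding sum.distrib[symmetric] by (rule sum.cong) (auto simp: R_def w')
  finally show "fps_nth (gen_series (odds \<times> odds) (\<lambda>(n, m). n\<^sup>2 + m\<^sup>2) w) N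
       = fps_nth (gen_series (odds \<times> UNIV) (\<lambda>(a, v). 2 * a\<^sup>2 + 8 * v\<^sup>2) w') N"
    by (simp add: gen_series_nth S_def R_def)
qed

section \<open>Theta series identities\<close>

lemma chi4_shift:
  assumes "odd a"
  shows "chi4 (a + 2 * v) = chi4 a * alt v" "chi4 (a - 2 * v) = chi4 a * alt v"
proof -
  have *: "(a + 2 * v) mod 4 = (a mod 4 + 2 * (v mod 2)) mod 4"
    "(a - 2 * v) mod 4 = (a mod 4 - 2 * (v mod 2)) mod 4"
    using mult_mod_right[of 2 v 2] by (simp_all add: mod_simps)
  have v: "v mod 2 = 0 \<and> even v \<or> v mod 2 = 1 \<and> odd v" by presburger
  show "chi4 (a + 2 * v) = chi4 a * alt v"
    using assms v unfolding odd_mod_4[of a] chi4_def alt_def * by (elim disjE conjE; simp)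
  show "chi4 (a - 2 * v) = chi4 a * alt v"
    using assms v unfolding odd_mod_4[of a] chi4_def alt_def * by (elim disjE conjE; simp)
qed

lemma chi8_minus: "chi8 (- n) = chi8 n"
  by (auto simp: chi8_def zmod_zminus1_eq_if)

text \<open>The product (a + 2v)(a - 2v) = a^2 - 4v^2 is 1 or 5 modulo 8 as v is even or odd, and
  (2/1) = 1, (2/5) = -1.\<close>

lemma chi8_pair:
  assumes "odd a"
  shows "chi8 (a + 2 * v) * chi8 (a - 2 * v) = alt v"
proof -
  have *: "(a + 2 * v) mod 8 = (a mod 8 + 2 * (v mod 4)) mod 8"
    "(a - 2 * v) mod 8 = (a mod 8 - 2 * (v mod 4)) mod 8"
    using mult_mod_right[of 2 v 4] by (simp_all add: mod_simps)
  have "v mod 4 = 0 \<and> even v \<or> v mod 4 = 1 \<and> odd v \<or> v mod 4 = 2 \<and> even v \<or> v mod 4 = 3 \<and> odd v"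
    by presburger
  then show ?thesis
    using assms unfolding odd_mod_8[of a] chi8_def alt_def * by (elim disjE conjE; simp)
qed

text \<open>With \<open>Q = q\<^sup>8\<close> and Ramanujan's \<open>\<phi>\<close>, \<open>\<psi>\<close>: \<open>theta_P = 2q \<psi>(Q)\<close>, \<open>theta_P' = 2q \<psi>(-Q)\<close>,
  \<open>theta_G = 2q\<^sup>2 \<psi>(Q\<^sup>2)\<close>, \<open>theta_F = \<phi>(Q)\<close>, \<open>theta_F' = \<phi>(-Q)\<close>, \<open>theta_H' = \<phi>(-Q\<^sup>2)\<close>,
  while \<open>theta_U\<close> is \<open>theta_T\<close> at \<open>q\<^sup>2\<close>.\<close>

definition theta_T :: "int fps" where "theta_T = gen_series odds (\<lambda>n. n\<^sup>2) (\<lambda>n. chi4 n * n)"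
definition theta_P :: "int fps" where "theta_P = gen_series odds (\<lambda>n. n\<^sup>2) (\<lambda>_. 1)"
definition theta_P' :: "int fps" where "theta_P' = gen_series odds (\<lambda>n. n\<^sup>2) chi8"
definition theta_U :: "int fps" where "theta_U = gen_series odds (\<lambda>n. 2 * n\<^sup>2) (\<lambda>n. chi4 n * n)"
definition theta_G :: "int fps" where "theta_G = gen_series odds (\<lambda>n. 2 * n\<^sup>2) (\<lambda>_. 1)"
definition theta_F :: "int fps" where "theta_F = gen_series UNIV (\<lambda>n. 8 * n\<^sup>2) (\<lambda>_. 1)"
definition theta_F' :: "int fps" where "theta_F' = gen_series UNIV (\<lambda>n. 8 * n\<^sup>2) alt"
definition theta_H' :: "int fps" where "theta_H' = gen_series UNIV (\<lambda>n. 16 * n\<^sup>2) alt"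

lemmas graded_intros = graded_prod graded_square graded_square1

text \<open>Symmetrising chi4(n) n over the sign of v leaves 2a chi4(a) alt(v), which separates into
  a factor in a and a factor in v.\<close>

lemma T_mult_P: "theta_T * theta_P = of_int 2 * (theta_U * theta_F')"
  unfolding theta_T_def theta_P_def theta_U_def theta_F'_def
  apply (simp add: gen_series_mult graded_intros gen_series_const del: of_int_numeral)
  apply (subst gen_series_odd_pairs)
    apply (auto intro!: gen_series_cong simp: chi4_shift)
  apply (simp add: algebra_simps)
  done

text \<open>The weight is chi4(n) n (n^2 - m^2) with n^2 - m^2 = 8av. Symmetrising leaves 32 a v^2
  chi4(a) alt(v), and 32 a v^2 is 4a times the exponent 8v^2 in \<open>theta_F'\<close>.\<close>

lemma T_P_Wronskian:
  "fps_XD theta_T * theta_P - theta_T * fps_XD theta_P = of_int 4 * (theta_U * fps_XD theta_F')"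
  unfolding theta_T_def theta_P_def theta_U_def theta_F'_def gen_series_XD
  apply (simp add: gen_series_mult graded_intros gen_series_const gen_series_diff del: of_int_numeral)
  apply (subst gen_series_odd_pairs)
    apply (auto intro!: gen_series_cong simp: chi4_shift)
  apply (simp_all add: algebra_simps power2_eq_square)
  done

lemma P_square: "theta_P * theta_P = of_int 2 * (theta_F * theta_G)"
  unfolding theta_P_def theta_F_def theta_G_def mult.commute[of "gen_series UNIV _ _"]
  apply (simp add: gen_series_mult graded_intros gen_series_const del: of_int_numeral)
  apply (subst gen_series_odd_pairs)
    apply (auto intro!: gen_series_cong)
  done

text \<open>By \<open>chi8_pair\<close> the sign depends on v alone, so the factor in a is the same
  \<open>theta_G\<close> as in \<open>P_square\<close>; this common factor makes the two squares
  comparable.\<close>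

lemma P'_square: "theta_P' * theta_P' = of_int 2 * (theta_F' * theta_G)"
  unfolding theta_P'_def theta_F'_def theta_G_def mult.commute[of "gen_series UNIV _ _"]
  apply (simp add: gen_series_mult graded_intros gen_series_const del: of_int_numeral)
  apply (subst gen_series_odd_pairs)
    apply (auto intro!: gen_series_cong simp: chi8_minus chi8_pair mult.commute[of "chi8 (_ - _)"])
  done

text \<open>Pairs (u, v) of opposite parity cancel when u and v are exchanged. For equal parity put
  u = a + b, v = a - b: then u^2 + v^2 = 2a^2 + 2b^2 and the sign of v is alt(a) alt(b).\<close>

lemma F_mult_F': "theta_F * theta_F' = theta_H' * theta_H'"
proof (rule fps_ext)
  fix N :: nat
  define S where "S = {p :: int \<times> int. (case p of (u, v) \<Rightarrow> 8 * u\<^sup>2 + 8 * v\<^sup>2) = int N}"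
  define S0 where "S0 = {p \<in> S. even (fst p + snd p)}"
  define S1 where "S1 = {p \<in> S. odd (fst p + snd p)}"
  define R where "R = {p :: int \<times> int. (case p of (u, v) \<Rightarrow> 16 * u\<^sup>2 + 16 * v\<^sup>2) = int N}"
  let ?w = "\<lambda>(u, v). alt v"
  have "finite S" unfolding S_def
    using graded_finite[of _ UNIV, OF graded_prod[OF graded_square graded_square], of 8 8] by simp
  moreover have "S = S0 \<union> S1" "S0 \<inter> S1 = {}" by (auto simp: S0_def S1_def)
  ultimately have "sum ?w S = sum ?w S0 + sum ?w S1"
    using sum.union_disjoint[of S0 S1 ?w] by (simp add: finite_Un)
  moreover have "sum ?w S1 = (\<Sum>p\<in>S1. - ?w p)"
    by (rule sum.reindex_bij_witness[where i = "\<lambda>(u, v). (v, u)" and j = "\<lambda>(u, v). (v, u)"])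
       (auto simp: S1_def S_def alt_def)
  hence "sum ?w S1 = 0" by (simp add: sum_negf)
  moreover have "sum ?w S0 = (\<Sum>(a, b)\<in>R. alt a * alt b)"
  proof (rule sum.reindex_bij_witness[where j = "\<lambda>(u, v). ((u + v) div 2, (u - v) div 2)" and i = "\<lambda>(a, b). (a + b, a - b)"]; clarsimp simp: S0_def S_def R_def)
    fix u v :: int
    assume h: "even u = even v" "8 * u\<^sup>2 + 8 * v\<^sup>2 = int N"
    then have "even (u - v)" by simp
    then obtain b where b: "u - v = 2 * b" by (rule evenE)
    define a where "a = v + b"
    have uv: "u = a + b" "v = a - b" using b by (auto simp: a_def)
    show "(u + v) div 2 + (u - v) div 2 = u \<and> (u + v) div 2 - (u - v) div 2 = v" 
      "16 * ((u + v) div 2)\<^sup>2 + 16 * ((u - v) div 2)\<^sup>2 = int N"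
      "alt ((u + v) div 2) * alt ((u - v) div 2) = alt v"
      using h(2) unfolding uv by (auto simp add: power2_eq_square algebra_simps alt_def)
  qed (auto simp: power2_eq_square algebra_simps)
  ultimately show "fps_nth (theta_F * theta_F') N = fps_nth (theta_H' * theta_H') N"
    by (simp add: theta_F_def theta_F'_def theta_H'_def gen_series_mult graded_intros gen_series_nth S_def R_def)
qed

text \<open>The relation is linear in f, so h = f - g satisfies it too. If h and g start at q^m and
  q^n, the lowest coefficients give (m - n) h_m g_n = 0, so m = n; but h vanishes at that index by
  hypothesis.\<close>

lemma fps_eq_if_Wronskian_zero:
  fixes f g :: "'a :: {idom, ring_char_0} fps"
  assumes W: "fps_XD f * g = f * fps_XD g"
    and eq: "fps_nth f (subdegree g) = fps_nth g (subdegree g)"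
    and g: "g \<noteq> 0"
  shows "f = g"
proof (rule ccontr)
  assume "f \<noteq> g"
  define h where "h = f - g"
  have h: "h \<noteq> 0" using \<open>f \<noteq> g\<close> by (simp add: h_def)
  have f: "f = h + g" by (simp add: h_def)
  have eqn: "fps_XD h * g = h * fps_XD g"
    using W unfolding f by (simp add: algebra_simps)
  let ?m = "subdegree h" and ?n = "subdegree g"
  have lead: "fps_nth (a * b) (?m + ?n) = fps_nth a ?m * fps_nth b ?n"
    if "\<And>i. i < ?m \<Longrightarrow> fps_nth a i = 0" "\<And>i. i < ?n \<Longrightarrow> fps_nth b i = 0" for a b :: "'a fps"
  proof -
    have "fps_nth (a * b) (?m + ?n) = (\<Sum>i=0..?m + ?n. fps_nth a i * fps_nth b (?m + ?n - i))"
      by (simp add: fps_mult_nth)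
    also have "\<dots> = (\<Sum>i\<in>{?m}. fps_nth a i * fps_nth b (?m + ?n - i))"
    proof (rule sum.mono_neutral_right)
      show "\<forall>i\<in>{0..?m + ?n} - {?m}. fps_nth a i * fps_nth b (?m + ?n - i) = 0"
      proof
        fix i assume "i \<in> {0..?m + ?n} - {?m}"
        then have "i < ?m \<or> ?m + ?n - i < ?n" by auto
        then show "fps_nth a i * fps_nth b (?m + ?n - i) = 0" using that by auto
      qed
    qed auto
    finally show ?thesis by simp
  qed
  have "of_nat ?m * fps_nth h ?m * fps_nth g ?n = fps_nth h ?m * (of_nat ?n * fps_nth g ?n)"
    using arg_cong[OF eqn, of "\<lambda>s. fps_nth s (?m + ?n)"] by (simp add: lead nth_less_subdegree_zero)
  then have "(of_nat ?m - of_nat ?n :: 'a) * (fps_nth h ?m * fps_nth g ?n) = 0"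
    by (simp add: algebra_simps)
  then have "?m = ?n" using h g by auto
  then have "fps_nth h ?m = 0" using eq by (simp add: h_def)
  then show False using h by simp
qed

lemma fps_XD_mult: "fps_XD (f * g) = fps_XD f * g + f * fps_XD (g :: 'a :: comm_ring_1 fps)"
  by (simp add: fps_XD_def algebra_simps)

lemma square_fibers:
  "{x::int. odd x \<and> x\<^sup>2 = 1} = {1, -1}" "{x::int. x\<^sup>2 = 0} = {0}" "{x::int. 8 * x\<^sup>2 = 1} = {}"  "{x::int. 16 * x\<^sup>2 = 1} = {}" "{x::int. 16 * x\<^sup>2 = 0} = {0}" "{x::int. 8 * x\<^sup>2 = 0} = {0}" "{x::int. odd x \<and> x = 0} = {}"
proof -
  have "8 * y \<noteq> 1" "16 * y \<noteq> 1" for y :: int by presburger+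
  then show "{x::int. 8 * x\<^sup>2 = 1} = {}" "{x::int. 16 * x\<^sup>2 = 1} = {}" by auto
qed (auto simp: power2_eq_1_iff)

lemma low_coeffs:
  "fps_nth theta_P 0 = 0" "fps_nth theta_P' 0 = 0" "fps_nth theta_T 0 = 0"
  "fps_nth theta_P 1 = 2" "fps_nth theta_P' 1 = 2" "fps_nth theta_T 1 = 2"
  "fps_nth theta_F 0 = 1" "fps_nth theta_F' 0 = 1" "fps_nth theta_H' 0 = 1"
  by (simp_all add: theta_P_def theta_P'_def theta_T_def theta_F_def theta_F'_def theta_H'_def gen_series_nth square_fibers alt_def chi4_def chi8_def)

lemma fps_nth_mult_1: "fps_nth (f * g) 1 = fps_nth f 0 * fps_nth g 1 + fps_nth f 1 * fps_nth (g :: int fps) 0"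
  by (simp add: fps_mult_nth)

text \<open>By \<open>T_P_Wronskian\<close> and \<open>T_mult_P\<close> both terms of the Wronskian
  become 4 U F'^2 D(F') with D = q d/dq, and they cancel. Both series start with 2q.\<close>

lemma T_eq: "theta_T = theta_P * theta_F' * theta_F'"
proof (rule fps_eq_if_Wronskian_zero)
  let ?A = "theta_P * theta_F' * theta_F'"
  have c0: "fps_nth ?A 0 = 0" by (simp add: low_coeffs fps_mult_nth_0)
  have c1: "fps_nth ?A 1 = 2" by (simp only: fps_nth_mult_1 low_coeffs fps_mult_nth_0) simp
  show "?A \<noteq> 0" using c1 by auto
  have "subdegree ?A = 1" by (rule subdegreeI) (use c0 c1 in auto)
  then show "fps_nth theta_T (subdegree ?A) = fps_nth ?A (subdegree ?A)" using c1 by (simp add: low_coeffs del: One_nat_def)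
  have "fps_XD theta_T * ?A - theta_T * fps_XD ?A
      = (fps_XD theta_T * theta_P - theta_T * fps_XD theta_P) * theta_F' * theta_F'
        - 2 * (theta_T * theta_P) * theta_F' * fps_XD theta_F'"
    by (simp add: fps_XD_mult algebra_simps)
  also have "\<dots> = 0" unfolding T_P_Wronskian T_mult_P by (simp add: algebra_simps)
  finally show "fps_XD theta_T * ?A = theta_T * fps_XD ?A" by simp
qed

text \<open>Both sides have the same square; the coefficient of \<open>q\<close> fixes the sign.\<close>

lemma P'F_eq: "theta_P' * theta_F = theta_P * theta_H'"
proof -
  have "(theta_P' * theta_F) * (theta_P' * theta_F) = (theta_P' * theta_P') * theta_F * theta_F"
    by (simp add: mult_ac)
  also have "\<dots> = of_int 2 * (theta_F * theta_G) * (theta_F * theta_F')"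
    unfolding P'_square by (simp add: mult_ac)
  also have "\<dots> = (theta_P * theta_H') * (theta_P * theta_H')"
    unfolding P_square[symmetric] F_mult_F' by (simp add: mult_ac)
  finally have "theta_P' * theta_F = theta_P * theta_H' \<or> theta_P' * theta_F = - (theta_P * theta_H')"
    by (simp add: square_eq_iff)
  moreover have "fps_nth (theta_P' * theta_F) 1 = 2" "fps_nth (theta_P * theta_H') 1 = 2"
    by (simp_all only: fps_nth_mult_1 low_coeffs)
  ultimately show ?thesis by (auto simp del: One_nat_def)
qed

section \<open>Representations with coordinate conditions\<close>

definition reps :: "(int \<times> int \<times> int \<Rightarrow> int) \<Rightarrow> (int \<times> int \<times> int \<Rightarrow> bool) \<Rightarrow> int \<Rightarrow> nat" where
  "reps f P k = card {v. f v = k \<and> P v}"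

abbreviation "reps111 \<equiv> reps (diag_form 1 1 1)"
abbreviation "reps112 \<equiv> reps (diag_form 1 1 2)"

lemma num_reps_eq_reps: "num_reps k f = reps f (\<lambda>_. True) k"
  by (simp add: num_reps_def reps_def)

lemma finite_diag_form:
  assumes "a > 0" "b > 0" "c > 0"
  shows "finite {v. diag_form a b c v = k \<and> P v}"
proof -
  have "graded (\<lambda>(x, yz). a * x\<^sup>2 + (case yz of (y, z) \<Rightarrow> b * y\<^sup>2 + c * z\<^sup>2))"
    using assms by (intro graded_prod graded_square)
  from graded_finite[OF this, of "Collect P" k] show ?thesis
    by (rule rev_finite_subset) (auto simp: diag_form_def)
qed

lemma reps_cong:
  "(\<And>x y z. f (x, y, z) = k \<Longrightarrow> P (x, y, z) \<longleftrightarrow> Q (x, y, z)) \<Longrightarrow> reps f P k = reps f Q k"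
  unfolding reps_def by (rule arg_cong[where f = card]) auto

lemma reps_eq_0: "(\<And>x y z. f (x, y, z) = k \<Longrightarrow> \<not> P (x, y, z)) \<Longrightarrow> reps f P k = 0"
proof -
  assume "\<And>x y z. f (x, y, z) = k \<Longrightarrow> \<not> P (x, y, z)"
  then have empty: "{v. f v = k \<and> P v} = {}" by auto
  show ?thesis unfolding reps_def empty by simp
qed

lemma reps_split:
  assumes "a > 0" "b > 0" "c > 0"
  shows "reps (diag_form a b c) P k
    = reps (diag_form a b c) (\<lambda>v. P v \<and> Q v) k + reps (diag_form a b c) (\<lambda>v. P v \<and> \<not> Q v) k"
  unfolding reps_def
  by (subst card_Un_disjoint[symmetric]) (auto intro!: finite_diag_form assms arg_cong[where f = card])

lemma reps_reindex:
  assumes "inj h"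
    and "\<And>x y z. g (x, y, z) = l \<Longrightarrow> Q (x, y, z) \<Longrightarrow> f (h (x, y, z)) = k \<and> P (h (x, y, z))"
    and "\<And>x y z. f (x, y, z) = k \<Longrightarrow> P (x, y, z) \<Longrightarrow>
      \<exists>x' y' z'. h (x', y', z') = (x, y, z) \<and> g (x', y', z') = l \<and> Q (x', y', z')"
  shows "reps f P k = reps g Q l"
proof -
  have "{v. f v = k \<and> P v} = h ` {v. g v = l \<and> Q v}"
  proof (intro equalityI subsetI)
    fix v assume v: "v \<in> {v. f v = k \<and> P v}"
    obtain x y z where "v = (x, y, z)" by (cases v)
    with v assms(3)[of x y z] show "v \<in> h ` {v. g v = l \<and> Q v}" by force
  qed (use assms(2) in auto)
  then show ?thesis
    using assms(1) by (simp add: reps_def card_image inj_on_subset)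
qed

lemma reps111_swap12: "reps111 (\<lambda>(x, y, z). P x y z) k = reps111 (\<lambda>(x, y, z). P y x z) k"
  by (rule reps_reindex[where h = "\<lambda>(x, y, z). (y, x, z)"]) (auto simp: inj_def diag_form_def add_ac)

lemma reps111_swap23: "reps111 (\<lambda>(x, y, z). P x y z) k = reps111 (\<lambda>(x, y, z). P x z y) k"
  by (rule reps_reindex[where h = "\<lambda>(x, y, z). (x, z, y)"]) (auto simp: inj_def diag_form_def add_ac)

lemma reps112_swap12: "reps112 (\<lambda>(x, y, z). P x y z) k = reps112 (\<lambda>(x, y, z). P y x z) k"
  by (rule reps_reindex[where h = "\<lambda>(x, y, z). (y, x, z)"]) (auto simp: inj_def diag_form_def add_ac)

text \<open>The three alternatives partition the solutions, and permuting coordinates identifies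
  their counts.\<close>

lemma reps111_third:
  assumes "\<And>x y z. diag_form 1 1 1 (x, y, z) = k \<Longrightarrow>
    p x \<and> \<not> p y \<and> \<not> p z \<or> \<not> p x \<and> p y \<and> \<not> p z \<or> \<not> p x \<and> \<not> p y \<and> p z"
  shows "reps111 (\<lambda>_. True) k = 3 * reps111 (\<lambda>(x, y, z). p z) k"
    and "reps111 (\<lambda>(x, y, z). p x) k = reps111 (\<lambda>(x, y, z). p z) k"
proof -
  let ?x = "\<lambda>(x, y, z). p x" and ?y = "\<lambda>(x, y, z). p y" and ?z = "\<lambda>(x, y, z). p z"
  have "reps111 (\<lambda>_. True) k = reps111 ?x k + reps111 (\<lambda>v. \<not> ?x v) k"
    using reps_split[of 1 1 1 "\<lambda>_. True" k ?x] by simp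
  also have "reps111 (\<lambda>v. \<not> ?x v) k = reps111 (\<lambda>v. \<not> ?x v \<and> ?y v) k + reps111 (\<lambda>v. \<not> ?x v \<and> \<not> ?y v) k"
    by (rule reps_split) auto
  also have "reps111 (\<lambda>v. \<not> ?x v \<and> ?y v) k = reps111 ?y k"
    by (rule reps_cong) (use assms in force)
  also have "reps111 (\<lambda>v. \<not> ?x v \<and> \<not> ?y v) k = reps111 ?z k"
    by (rule reps_cong) (use assms in force)
  finally show "reps111 (\<lambda>_. True) k = 3 * reps111 ?z k" "reps111 ?x k = reps111 ?z k"
    unfolding reps111_swap12[of "\<lambda>x y z. p x" k] reps111_swap23[of "\<lambda>x y z. p y" k] by simp_all
qed

text \<open>Exchanging x and y keeps the condition on z and swaps the solutions with q y with their
  complement.\<close>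

lemma reps111_half:
  assumes "\<And>x y z. diag_form 1 1 1 (x, y, z) = k \<Longrightarrow> p z \<Longrightarrow> q x \<noteq> q y"
  shows "reps111 (\<lambda>(x, y, z). p z) k = 2 * reps111 (\<lambda>(x, y, z). q y \<and> p z) k"
proof -
  have "reps111 (\<lambda>(x, y, z). p z) k = reps111 (\<lambda>v. (\<lambda>(x, y, z). p z) v \<and> (\<lambda>(x, y, z). q y) v) k
      + reps111 (\<lambda>v. (\<lambda>(x, y, z). p z) v \<and> \<not> (\<lambda>(x, y, z). q y) v) k"
    by (rule reps_split) auto
  also have "reps111 (\<lambda>v. (\<lambda>(x, y, z). p z) v \<and> (\<lambda>(x, y, z). q y) v) k = reps111 (\<lambda>(x, y, z). q y \<and> p z) k"
    by (rule reps_cong) auto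
  also have "reps111 (\<lambda>v. (\<lambda>(x, y, z). p z) v \<and> \<not> (\<lambda>(x, y, z). q y) v) k = reps111 (\<lambda>(x, y, z). q x \<and> p z) k"
    by (rule reps_cong) (simp, metis assms)
  also have "\<dots> = reps111 (\<lambda>(x, y, z). q y \<and> p z) k"
    by (rule reps111_swap12)
  finally show ?thesis by simp
qed

lemma reps112_half:
  assumes "\<And>x y z. diag_form 1 1 2 (x, y, z) = k \<Longrightarrow> q x \<noteq> q y"
  shows "reps112 (\<lambda>_. True) k = 2 * reps112 (\<lambda>(x, y, z). q y) k"
proof -
  have "reps112 (\<lambda>_. True) k = reps112 (\<lambda>(x, y, z). q y) k + reps112 (\<lambda>v. \<not> (\<lambda>(x, y, z). q y) v) k"
    using reps_split[of 1 1 2 "\<lambda>_. True" k "\<lambda>(x, y, z). q y"] by simp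
  also have "reps112 (\<lambda>v. \<not> (\<lambda>(x, y, z). q y) v) k = reps112 (\<lambda>(x, y, z). q x) k"
    by (rule reps_cong) (simp, metis assms)
  also have "\<dots> = reps112 (\<lambda>(x, y, z). q y) k"
    by (rule reps112_swap12)
  finally show ?thesis by simp
qed

section \<open>The four forms as restricted representations by <1,1,1> and <1,1,2>\<close>

lemma num_reps_L1: "num_reps k L1 = reps111 (\<lambda>(x, y, z). 4 dvd z) k"
  unfolding num_reps_eq_reps L1_def
  by (rule reps_reindex[where h = "\<lambda>(x, y, z). (x, y, 4 * z)", symmetric])
     (auto simp: inj_def diag_form_def power_mult_distrib elim!: dvdE)

lemma num_reps_L2: "num_reps k L2 = reps111 (\<lambda>(x, y, z). even y \<and> 4 dvd z) k"
  unfolding num_reps_eq_reps L2_def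
  by (rule reps_reindex[where h = "\<lambda>(x, y, z). (x, 2 * y, 4 * z)", symmetric])
     (auto simp: inj_def diag_form_def power_mult_distrib elim!: dvdE)

text \<open>Here 8y^2 = 2(2y)^2 becomes the third term of <1,1,2> and 64z^2 = (8z)^2 the
  second.\<close>

lemma num_reps_L3: "num_reps k L3 = reps112 (\<lambda>(x, y, z). 8 dvd y \<and> even z) k"
  unfolding num_reps_eq_reps L3_def
  by (rule reps_reindex[where h = "\<lambda>(x, y, z). (x, 8 * z, 2 * y)", symmetric])
     (auto simp: inj_def diag_form_def power_mult_distrib elim!: dvdE)

lemma num_reps_L4: "num_reps k L4 = reps111 (\<lambda>(x, y, z). 4 dvd y \<and> 4 dvd z) k"
  unfolding num_reps_eq_reps L4_def
  by (rule reps_reindex[where h = "\<lambda>(x, y, z). (x, 4 * y, 4 * z)", symmetric])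
     (auto simp: inj_def diag_form_def power_mult_distrib elim!: dvdE)

text \<open>\<open>r\<close> stands for \<open>x\<^sup>2 mod 16\<close>. Keeping it an opaque variable lets \<open>simp\<close> evaluate the finitely many
  cases of a congruence modulo 16.\<close>

definition square_class :: "int \<Rightarrow> int \<Rightarrow> bool" where
  "square_class x r \<longleftrightarrow> 4 dvd x \<and> even x \<and> r = 0 \<or> \<not> 4 dvd x \<and> even x \<and> r = 4
    \<or> \<not> 4 dvd x \<and> odd x \<and> r = 1 \<or> \<not> 4 dvd x \<and> odd x \<and> r = 9"

text \<open>Modulo 8 all odd squares are 1, so a triple has 27 cases instead of 64.\<close>

definition square_class_8 :: "int \<Rightarrow> int \<Rightarrow> bool" where
  "square_class_8 x r \<longleftrightarrow> 4 dvd x \<and> even x \<and> r = 0 \<or> \<not> 4 dvd x \<and> even x \<and> r = 4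
    \<or> \<not> 4 dvd x \<and> odd x \<and> r = 1"

text \<open>Since (8q + r)^2 = 64q^2 + 16qr + r^2, only the eight residues of x modulo 8 need to be
  checked.\<close>

lemma square_class: "square_class x (x\<^sup>2 mod 16)"
proof -
  define q where "q = x div 8"
  define r where "r = x mod 8"
  have x: "x = 8 * q + r" by (simp add: q_def r_def)
  have "x\<^sup>2 = 16 * (4 * q\<^sup>2 + q * r) + r\<^sup>2" unfolding x by (simp add: power2_eq_square algebra_simps)
  then have sq: "x\<^sup>2 mod 16 = r\<^sup>2 mod 16" by (metis mod_mult_self4)
  have "4 dvd x \<longleftrightarrow> 4 dvd r" "even x \<longleftrightarrow> even r" unfolding x by presburger+
  moreover have "r = 0 \<or> r = 1 \<or> r = 2 \<or> r = 3 \<or> r = 4 \<or> r = 5 \<or> r = 6 \<or> r = 7"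
    unfolding r_def by presburger
  ultimately show ?thesis unfolding sq square_class_def by (elim disjE; simp)
qed

lemma square_class_8: "square_class_8 x (x\<^sup>2 mod 8)"
proof -
  have "x\<^sup>2 mod 8 = x\<^sup>2 mod 16 mod 8" by (simp add: mod_mod_cancel)
  then show ?thesis using square_class[of x] unfolding square_class_def square_class_8_def by auto
qed

lemma square_classes_cases:
  assumes "diag_form a b c (x, y, z) = k"
  obtains r s t where "square_class x r" "square_class y s" "square_class z t"
    "(a * r + b * s + c * t) mod 16 = k mod 16"
proof
  show "(a * (x\<^sup>2 mod 16) + b * (y\<^sup>2 mod 16) + c * (z\<^sup>2 mod 16)) mod 16 = k mod 16"
    unfolding assms[symmetric] diag_form_def prod.case by (intro mod_add_cong mod_mult_right_eq)
qed (rule square_class)+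

lemma square_classes_8_cases:
  assumes "diag_form a b c (x, y, z) = k"
  obtains r s t where "square_class_8 x r" "square_class_8 y s" "square_class_8 z t"
    "(a * r + b * s + c * t) mod 8 = k mod 8"
proof
  show "(a * (x\<^sup>2 mod 8) + b * (y\<^sup>2 mod 8) + c * (z\<^sup>2 mod 8)) mod 8 = k mod 8"
    unfolding assms[symmetric] diag_form_def prod.case by (intro mod_add_cong mod_mult_right_eq)
qed (rule square_class_8)+

section \<open>Scaling by powers of 2 and passage between <1,1,2> and <1,1,1>\<close>

lemma diag_form_111_mult4_even:
  assumes "diag_form 1 1 1 (x, y, z) = 4 * k"
  shows "even x \<and> even y \<and> even z"
proof -
  define m where "m = 4 * k"
  have "diag_form 1 1 1 (x, y, z) = m" using assms by (simp add: m_def)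
  moreover have "m mod 8 = 0 \<or> m mod 8 = 4"
    unfolding m_def by presburger
  ultimately show ?thesis
    by - (erule square_classes_8_cases, unfold square_class_8_def, elim disjE conjE; simp)
qed

lemma reps111_mult4: "reps111 (\<lambda>_. True) (4 * k) = reps111 (\<lambda>_. True) k"
proof (rule reps_reindex[where h = "\<lambda>(x, y, z). (2 * x, 2 * y, 2 * z)"])
  fix x y z :: int
  assume s: "diag_form 1 1 1 (x, y, z) = 4 * k"
  from diag_form_111_mult4_even[OF s] show "\<exists>x' y' z'. (case (x', y', z') of (x, y, z) \<Rightarrow> (2 * x, 2 * y, 2 * z)) = (x, y, z) \<and>
      diag_form 1 1 1 (x', y', z') = k \<and> True"
    using s by (auto simp: diag_form_def power_mult_distrib elim!: evenE)
qed (auto simp: inj_def diag_form_def power_mult_distrib)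

text \<open>From (x + y)^2 + (x - y)^2 + 2z^2 = 2(x^2 + y^2 + z^2); conversely an even value forces
  the first two coordinates to have equal parity.\<close>

lemma reps112_mult2:
  "reps112 (\<lambda>(x, y, z). P x y z) (2 * k) = reps111 (\<lambda>(x, y, z). P (x + y) (x - y) z) k"
proof (rule reps_reindex[where h = "\<lambda>(x, y, z). (x + y, x - y, z)"])
  fix x y z :: int
  assume P: "(\<lambda>(x, y, z). P x y z) (x, y, z)" and "diag_form 1 1 2 (x, y, z) = 2 * k"
  then have s: "x\<^sup>2 + y\<^sup>2 + 2 * z\<^sup>2 = 2 * k" by (simp add: diag_form_def)
  have "x\<^sup>2 + y\<^sup>2 = 2 * (k - z\<^sup>2)" using s by simp
  then have "even (x\<^sup>2 + y\<^sup>2)" by simp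
  then have "even (x - y)" by simp
  then obtain b where b: "x - y = 2 * b" by (rule evenE)
  define a where "a = y + b"
  have xy: "x = a + b" "y = a - b" using b by (auto simp: a_def)
  have "a\<^sup>2 + b\<^sup>2 + z\<^sup>2 = k" using s unfolding xy by (simp add: power2_eq_square algebra_simps)
  then show "\<exists>x' y' z'. (case (x', y', z') of (x, y, z) \<Rightarrow> (x + y, x - y, z)) = (x, y, z) \<and>
      diag_form 1 1 1 (x', y', z') = k \<and> (\<lambda>(x, y, z). P (x + y) (x - y) z) (x', y', z')"
    using P xy by (intro exI[of _ a] exI[of _ b] exI[of _ z]) (simp add: diag_form_def)
qed (auto simp: inj_def diag_form_def power2_eq_square algebra_simps)

lemma reps112_mult2_total: "reps112 (\<lambda>_. True) (2 * k) = reps111 (\<lambda>_. True) k"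
  using reps112_mult2[of "\<lambda>_ _ _. True" k] by (simp add: case_prod_unfold)

text \<open>From (x + y)^2 + (x - y)^2 + (2z)^2 = 2(x^2 + y^2 + 2z^2); an even third coordinate
  forces equal parity of the other two.\<close>

lemma reps112_eq_reps111: "reps112 (\<lambda>_. True) k = reps111 (\<lambda>(x, y, z). even z) (2 * k)"
proof (rule reps_reindex[where h = "\<lambda>(x, y, z). (x + y, x - y, 2 * z)", symmetric])
  fix x y z :: int
  assume z: "(\<lambda>(x, y, z). even z) (x, y, z)" and "diag_form 1 1 1 (x, y, z) = 2 * k"
  then have s: "x\<^sup>2 + y\<^sup>2 + z\<^sup>2 = 2 * k" by (simp add: diag_form_def)
  obtain c where c: "z = 2 * c" using z by (auto elim: evenE)
  have "x\<^sup>2 + y\<^sup>2 = 2 * (k - 2 * c\<^sup>2)" using s c by (simp add: power_mult_distrib)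
  then have "even (x\<^sup>2 + y\<^sup>2)" by simp
  then have "even (x - y)" by simp
  then obtain b where b: "x - y = 2 * b" by (rule evenE)
  define a where "a = y + b"
  have xy: "x = a + b" "y = a - b" using b by (auto simp: a_def)
  have "a\<^sup>2 + b\<^sup>2 + 2 * c\<^sup>2 = k" using s unfolding xy c by (simp add: power2_eq_square algebra_simps)
  then show "\<exists>x' y' z'. (case (x', y', z') of (x, y, z) \<Rightarrow> (x + y, x - y, 2 * z)) = (x, y, z) \<and>
      diag_form 1 1 2 (x', y', z') = k \<and> True"
    using xy c by (intro exI[of _ a] exI[of _ b] exI[of _ c]) (simp add: diag_form_def)
qed (auto simp: inj_def diag_form_def power2_eq_square algebra_simps)

lemma reps112_mult4:
  "reps112 (\<lambda>(x, y, z). 8 dvd y \<and> even z) (4 * k) = reps112 (\<lambda>(x, y, z). 4 dvd y) k"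
proof (rule reps_reindex[where h = "\<lambda>(x, y, z). (2 * x, 2 * y, 2 * z)"])
  fix x y z :: int
  assume yz: "(\<lambda>(x, y, z). 8 dvd y \<and> even z) (x, y, z)" and "diag_form 1 1 2 (x, y, z) = 4 * k"
  then have s: "x\<^sup>2 + y\<^sup>2 + 2 * z\<^sup>2 = 4 * k" by (simp add: diag_form_def)
  from yz obtain y' z' where yz': "y = 8 * y'" "z = 2 * z'" by (auto simp: dvd_def)
  have "x\<^sup>2 = 2 * (2 * k - 32 * y'\<^sup>2 - 4 * z'\<^sup>2)" using s yz' by (simp add: power_mult_distrib)
  then have "even (x\<^sup>2)" by simp
  then have "even x" by simp
  then obtain x' where x': "x = 2 * x'" by (rule evenE)
  show "\<exists>x' y' z'. (case (x', y', z') of (x, y, z) \<Rightarrow> (2 * x, 2 * y, 2 * z)) = (x, y, z) \<and>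
      diag_form 1 1 2 (x', y', z') = k \<and> (\<lambda>(x, y, z). 4 dvd y) (x', y', z')"
    using s yz' x' by (intro exI[of _ x'] exI[of _ "4 * y'"] exI[of _ z']) (simp add: diag_form_def power_mult_distrib)
qed (auto simp: inj_def diag_form_def power_mult_distrib)

text \<open>With 4 | y and z even, x^2 + 2z^2 = 0 modulo 16 forces 4 | x and 4 | z, so all
  coordinates can be divided by 4.\<close>

lemma reps112_mult16:
  "reps112 (\<lambda>(x, y, z). 8 dvd y \<and> even z) (16 * k) = reps112 (\<lambda>(x, y, z). even y) k"
proof (rule reps_reindex[where h = "\<lambda>(x, y, z). (4 * x, 4 * y, 4 * z)"])
  fix x y z :: int
  assume yz: "(\<lambda>(x, y, z). 8 dvd y \<and> even z) (x, y, z)" and s: "diag_form 1 1 2 (x, y, z) = 16 * k"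
  from yz obtain y' where y': "y = 8 * y'" and z: "even z" by (auto simp: dvd_def)
  have y4: "4 dvd y" unfolding y' by simp
  have "4 dvd x \<and> 4 dvd z"
    using z y4 by - (rule square_classes_cases[OF s], unfold square_class_def, elim disjE conjE; simp)
  then obtain x' z' where "x = 4 * x'" "z = 4 * z'" by (auto simp: dvd_def)
  then show "\<exists>x' y' z'. (case (x', y', z') of (x, y, z) \<Rightarrow> (4 * x, 4 * y, 4 * z)) = (x, y, z) \<and>
      diag_form 1 1 2 (x', y', z') = k \<and> (\<lambda>(x, y, z). even y) (x', y', z')"
    using s y' by (intro exI[of _ x'] exI[of _ "2 * y'"] exI[of _ z']) (simp add: diag_form_def power_mult_distrib)
qed (auto simp: inj_def diag_form_def power_mult_distrib)

text \<open>All coordinates are even, with squares 0 or 4 modulo 16. Two fours give 8 and three give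
  12, so exactly one occurs.\<close>

lemma reps111_exceptional_even:
  assumes s: "diag_form 1 1 1 (x, y, z) = k" and k: "k mod 16 = 4"
  shows "even x \<and> even y \<and> even z \<and>
    (\<not> 4 dvd x \<and> 4 dvd y \<and> 4 dvd z \<or> 4 dvd x \<and> \<not> 4 dvd y \<and> 4 dvd z \<or> 4 dvd x \<and> 4 dvd y \<and> \<not> 4 dvd z)"
  using k by - (rule square_classes_cases[OF s], unfold square_class_def, elim disjE conjE; simp)

section \<open>Ratios of representation numbers\<close>

lemma rr1_eq: "rr1 k = reps111 (\<lambda>_. True) k" and rr2_eq: "rr2 k = reps112 (\<lambda>_. True) k"
  by (simp_all add: rr1_def rr2_def num_reps_eq_reps)

lemma four_dvd_double: "4 dvd 2 * n \<longleftrightarrow> even (n :: int)" by presburger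

lemma four_dvd_diff_iff_even:
  fixes x y :: int
  assumes "even x" "even y"
  shows "4 dvd x - y \<longleftrightarrow> (4 dvd x \<longleftrightarrow> 4 dvd y)"
proof -
  obtain p q where "x = 2 * p" "y = 2 * q" using assms by (auto elim!: evenE)
  then have "x - y = 2 * (p - q)" by simp
  show ?thesis
    unfolding \<open>x - y = _\<close> unfolding \<open>x = _\<close> \<open>y = _\<close> four_dvd_double by simp
qed

lemma four_dvd_add_iff_odd:
  fixes x y :: int
  assumes "odd x" "odd y"
  shows "4 dvd x + y \<longleftrightarrow> \<not> 4 dvd x - y"
proof -
  have "even (x - y)" using assms by simp
  then obtain p where p: "x - y = 2 * p" by (rule evenE)
  then have "x + y = 2 * (p + y)" by simp
  then show ?thesis unfolding p \<open>x + y = _\<close> four_dvd_double using assms by simp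
qed

lemma four_dvd_diff_parity: "4 dvd x - y \<Longrightarrow> even x = even (y :: int)"
  using dvd_trans[of 2 4 "x - y"] by simp

text \<open>Up to order the only sums of squares are 5 = 0 + 1 + 4 and 2 = 0 + 1 + 1 modulo 8, and 8
  = 0 + 4 + 4 modulo 16.\<close>

lemma exactly_one_4_dvd:
  assumes s: "diag_form 1 1 1 (x, y, z) = k" and "k mod 8 = 5 \<or> k mod 8 = 2 \<or> k mod 16 = 8"
  shows "4 dvd x \<and> \<not> 4 dvd y \<and> \<not> 4 dvd z \<or> \<not> 4 dvd x \<and> 4 dvd y \<and> \<not> 4 dvd z
    \<or> \<not> 4 dvd x \<and> \<not> 4 dvd y \<and> 4 dvd z"
proof -
  consider "k mod 8 = 5 \<or> k mod 8 = 2" | "k mod 16 = 8" using assms(2) by blast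
  then show ?thesis
  proof cases
    case 1
    then show ?thesis using s by - (erule square_classes_8_cases, unfold square_class_8_def, elim disjE conjE; simp)
  next
    case 2
    then show ?thesis using s by - (erule square_classes_cases, unfold square_class_def, elim disjE conjE; simp)
  qed
qed

text \<open>The only sums of squares are 3 = 1 + 1 + 1 and 6 = 1 + 1 + 4 modulo 8, and 12 = 4 + 4 +
  4 modulo 16; 7 modulo 8 does not occur.\<close>

lemma not_4_dvd:
  assumes s: "diag_form 1 1 1 (x, y, z) = k"
    and "k mod 8 = 3 \<or> k mod 8 = 6 \<or> k mod 8 = 7 \<or> k mod 16 = 12"
  shows "\<not> 4 dvd z"
proof -
  consider "k mod 8 = 3 \<or> k mod 8 = 6 \<or> k mod 8 = 7" | "k mod 16 = 12" using assms(2) by blast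
  then show ?thesis
  proof cases
    case 1
    then show ?thesis using s by - (erule square_classes_8_cases, unfold square_class_8_def, elim disjE conjE; simp)
  next
    case 2
    then show ?thesis using s by - (erule square_classes_cases, unfold square_class_def, elim disjE conjE; simp)
  qed
qed

lemma exactly_one_even:
  assumes "diag_form 1 1 1 (x, y, z) = k" "k mod 8 = 2 \<or> k mod 8 = 6"
  shows "even x \<and> \<not> even y \<and> \<not> even z \<or> \<not> even x \<and> even y \<and> \<not> even z
    \<or> \<not> even x \<and> \<not> even y \<and> even z"
  using assms by - (erule square_classes_8_cases, unfold square_class_8_def, elim disjE conjE; simp)

lemma exactly_one_odd:
  assumes "diag_form 1 1 1 (x, y, z) = k" "k mod 8 = 1 \<or> k mod 8 = 5"
  shows "odd x \<and> \<not> odd y \<and> \<not> odd z \<or> \<not> odd x \<and> odd y \<and> \<not> odd z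
    \<or> \<not> odd x \<and> \<not> odd y \<and> odd z"
  using assms by - (erule square_classes_8_cases, unfold square_class_8_def, elim disjE conjE; simp)

section \<open>Proportions for L1, L2 and L4\<close>

lemma L1_third:
  assumes "k mod 8 = 5 \<or> k mod 8 = 2 \<or> k mod 16 = 8"
  shows "rr1 k = 3 * num_reps k L1"
  unfolding rr1_eq num_reps_L1 by (rule reps111_third, rule exactly_one_4_dvd) (use assms in auto)

lemma L1_zero:
  assumes "k mod 8 = 3 \<or> k mod 8 = 6 \<or> k mod 8 = 7 \<or> k mod 16 = 12"
  shows "num_reps k L1 = 0"
  unfolding num_reps_L1 by (rule reps_eq_0) (use not_4_dvd[OF _ assms] in auto)

text \<open>Exactly one coordinate is not divisible by 4. It is z in a third of the solutions, and
  L1 counts the rest.\<close>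

lemma L1_two_thirds:
  assumes "k mod 16 = 4"
  shows "2 * rr1 k = 3 * num_reps k L1"
proof -
  have "rr1 k = 3 * reps111 (\<lambda>(x, y, z). \<not> 4 dvd z) k"
    unfolding rr1_eq by (rule reps111_third) (use reps111_exceptional_even[OF _ assms] in blast)
  moreover have "rr1 k = num_reps k L1 + reps111 (\<lambda>(x, y, z). \<not> 4 dvd z) k"
    using reps_split[of 1 1 1 "\<lambda>_. True" k "\<lambda>(x, y, z). 4 dvd z"]
    by (simp add: rr1_eq num_reps_L1 case_prod_unfold)
  ultimately show ?thesis by simp
qed

lemma diag_form_111_mod_16_0:
  assumes "diag_form 1 1 1 (x, y, z) = k" "k mod 16 = 0"
  shows "4 dvd x \<and> 4 dvd y \<and> 4 dvd z"
  using assms by - (erule square_classes_cases, unfold square_class_def, elim disjE conjE; simp)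

lemma mod_16_0:
  assumes "k mod 16 = 0"
  shows "num_reps k L1 = rr1 k" "num_reps k L2 = rr1 k" "num_reps k L4 = rr1 k"
  unfolding num_reps_L1 num_reps_L2 num_reps_L4 rr1_eq
  by (rule reps_cong, use diag_form_111_mod_16_0[OF _ assms] in force)+

lemma L2_eq_L1:
  assumes "k mod 16 = 4 \<or> k mod 16 = 8"
  shows "num_reps k L2 = num_reps k L1"
  unfolding num_reps_L1 num_reps_L2
proof (rule reps_cong, unfold prod.case)
  fix x y z assume "diag_form 1 1 1 (x, y, z) = k"
  moreover have "k = 4 * (k div 4)" using assms by presburger
  ultimately have "even y" using diag_form_111_mult4_even[of x y z "k div 4"] by simp
  then show "even y \<and> 4 dvd z \<longleftrightarrow> 4 dvd z" by simp
qed

lemma L1_eq_double_L2: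
  assumes "k mod 8 = 1 \<or> k mod 8 = 5"
  shows "num_reps k L1 = 2 * num_reps k L2"
  unfolding num_reps_L1 num_reps_L2
proof (rule reps111_half)
  fix x y z :: int assume "diag_form 1 1 1 (x, y, z) = k" "4 dvd z"
  moreover from this(2) have "even z" by presburger
  ultimately show "even x \<noteq> even y" using exactly_one_odd[OF _ assms] by blast
qed

lemma L2_zero:
  assumes "k mod 8 = 2 \<or> k mod 8 = 3 \<or> k mod 8 = 6 \<or> k mod 8 = 7 \<or> k mod 16 = 12"
  shows "num_reps k L2 = 0"
  unfolding num_reps_L2
proof (rule reps_eq_0, unfold prod.case)
  fix x y z assume s: "diag_form 1 1 1 (x, y, z) = k"
  show "\<not> (even y \<and> 4 dvd z)"
  proof (cases "k mod 8 = 2")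
    case True
    then show ?thesis using s by - (erule square_classes_8_cases, unfold square_class_8_def, elim disjE conjE; simp)
  next
    case False
    then show ?thesis using assms not_4_dvd[OF s] by blast
  qed
qed

lemma L4_zero:
  assumes "k mod 8 = 2 \<or> k mod 8 = 3 \<or> k mod 8 = 5 \<or> k mod 8 = 6 \<or> k mod 8 = 7 \<or> k mod 16 = 8 \<or> k mod 16 = 12"
  shows "num_reps k L4 = 0"
  unfolding num_reps_L4
proof (rule reps_eq_0, unfold prod.case)
  fix x y z assume s: "diag_form 1 1 1 (x, y, z) = k"
  show "\<not> (4 dvd y \<and> 4 dvd z)"
    using assms not_4_dvd[OF s] exactly_one_4_dvd[OF s] by blast
qed

text \<open>The conditions 4 | y and 4 | z say that the one coordinate not divisible by 4 is
  x.\<close>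

lemma L4_third:
  assumes "k mod 16 = 4"
  shows "rr1 k = 3 * num_reps k L4"
proof -
  have "rr1 k = 3 * reps111 (\<lambda>(x, y, z). \<not> 4 dvd z) k"
    and "reps111 (\<lambda>(x, y, z). \<not> 4 dvd x) k = reps111 (\<lambda>(x, y, z). \<not> 4 dvd z) k"
    unfolding rr1_eq by (rule reps111_third; use reps111_exceptional_even[OF _ assms] in blast)+
  moreover have "reps111 (\<lambda>(x, y, z). \<not> 4 dvd x) k = num_reps k L4"
    unfolding num_reps_L4 by (rule reps_cong) (use reps111_exceptional_even[OF _ assms] in force)
  ultimately show ?thesis by simp
qed

text \<open>Modulo 8, 1 is 1 + 0 + 0 or 1 + 4 + 4, so the two even coordinates are divisible by 4
  together.\<close>

lemma L4_eq_L2: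
  assumes "k mod 8 = 1"
  shows "num_reps k L4 = num_reps k L2"
  unfolding num_reps_L4 num_reps_L2
proof (rule reps_cong, unfold prod.case)
  fix x y z assume "diag_form 1 1 1 (x, y, z) = k"
  then show "4 dvd y \<and> 4 dvd z \<longleftrightarrow> even y \<and> 4 dvd z" using assms by - (erule square_classes_8_cases, unfold square_class_8_def, elim disjE conjE; simp)
qed

section \<open>Proportions for L3\<close>

lemma L3_zero:
  assumes "k mod 8 = 3 \<or> k mod 8 = 5 \<or> k mod 8 = 7 \<or> k mod 8 = 2 \<or> k mod 8 = 6"
  shows "num_reps k L3 = 0"
  unfolding num_reps_L3
proof (rule reps_eq_0, unfold prod.case)
  fix x y z assume "diag_form 1 1 2 (x, y, z) = k"
  then have "\<not> (4 dvd y \<and> even z)" using assms by - (erule square_classes_8_cases, unfold square_class_8_def, elim disjE conjE; simp)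
  then show "\<not> (8 dvd y \<and> even z)" by presburger
qed

lemma reps111_double_odd_third:
  assumes "odd m"
  shows "reps111 (\<lambda>_. True) (2 * m) = 3 * reps111 (\<lambda>(x, y, z). even z) (2 * m)"
proof (rule reps111_third)
  have "(2 * m) mod 8 = 2 \<or> (2 * m) mod 8 = 6" using assms by presburger
  then show "even x \<and> \<not> even y \<and> \<not> even z \<or> \<not> even x \<and> even y \<and> \<not> even z
    \<or> \<not> even x \<and> \<not> even y \<and> even z" if "diag_form 1 1 1 (x, y, z) = 2 * m" for x y z
    using exactly_one_even[OF that] by blast
qed

text \<open>The factor 6 is 3 times 2. The 3 comes from the place of the even coordinate in r1(2m).
  The 2 comes from r2(m): for m = 1, 3 modulo 8 the even one of x, y is divisible by 4.\<close>

lemma L3_mult4: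
  assumes "m mod 8 = 1 \<or> m mod 8 = 3"
  shows "rr2 (4 * m) = 6 * num_reps (4 * m) L3"
proof -
  have "odd m" using assms by presburger
  have "rr2 (4 * m) = reps111 (\<lambda>_. True) (2 * m)"
    using reps112_mult2_total[of "2 * m"] by (simp add: rr2_eq)
  also have "\<dots> = 3 * reps112 (\<lambda>_. True) m"
    using reps111_double_odd_third[OF \<open>odd m\<close>] by (simp add: reps112_eq_reps111)
  also have "reps112 (\<lambda>_. True) m = 2 * reps112 (\<lambda>(x, y, z). 4 dvd y) m"
  proof (rule reps112_half)
    fix x y z :: int assume "diag_form 1 1 2 (x, y, z) = m"
    then show "(4 dvd x) \<noteq> (4 dvd y)" using assms by - (erule square_classes_8_cases, unfold square_class_8_def, elim disjE conjE; simp)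
  qed
  finally show ?thesis by (simp add: num_reps_L3 reps112_mult4)
qed

lemma L3_mult4_zero:
  assumes "m mod 8 = 5 \<or> m mod 8 = 7"
  shows "num_reps (4 * m) L3 = 0"
  unfolding num_reps_L3 reps112_mult4
proof (rule reps_eq_0, unfold prod.case)
  fix x y z assume "diag_form 1 1 2 (x, y, z) = m"
  then show "\<not> 4 dvd y" using assms by - (erule square_classes_8_cases, unfold square_class_8_def, elim disjE conjE; simp)
qed

lemma rr2_mult8: "rr2 (8 * m) = rr1 m"
  using reps112_mult2_total[of "4 * m"] by (simp add: rr1_eq rr2_eq reps111_mult4)

lemma L3_mult8: "num_reps (8 * m) L3 = reps111 (\<lambda>(x, y, z). 4 dvd x - y) m"
  using reps112_mult4[of "2 * m"] reps112_mult2[of "\<lambda>x y z. 4 dvd y" m] by (simp add: num_reps_L3)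

text \<open>If z is the odd coordinate, x and y are even and divisible by 4 together, so 4 | x - y;
  otherwise x - y is odd.\<close>

lemma L3_mult8_third:
  assumes "m mod 8 = 1"
  shows "rr2 (8 * m) = 3 * num_reps (8 * m) L3"
proof -
  have "rr1 m = 3 * reps111 (\<lambda>(x, y, z). odd z) m"
    unfolding rr1_eq by (rule reps111_third) (use exactly_one_odd[of _ _ _ m] assms in blast)
  moreover have "reps111 (\<lambda>(x, y, z). 4 dvd x - y) m = reps111 (\<lambda>(x, y, z). odd z) m"
  proof (rule reps_cong, unfold prod.case)
    fix x y z assume "diag_form 1 1 1 (x, y, z) = m"
    then have "odd z \<and> even x \<and> even y \<and> (4 dvd x \<longleftrightarrow> 4 dvd y) \<or> even z \<and> even x \<noteq> even y"
      using assms by - (erule square_classes_8_cases, unfold square_class_8_def, elim disjE conjE; simp)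
    then show "4 dvd x - y \<longleftrightarrow> odd z" using four_dvd_diff_iff_even four_dvd_diff_parity by blast
  qed
  ultimately show ?thesis by (simp add: rr2_mult8 L3_mult8)
qed

lemma diag_form_111_all_odd:
  assumes "diag_form 1 1 1 (x, y, z) = k" "k mod 8 = 3"
  shows "odd x \<and> odd y \<and> odd z"
  using assms by - (erule square_classes_8_cases, unfold square_class_8_def, elim disjE conjE; simp)

text \<open>All coordinates are odd, so 4 divides exactly one of x - y and x + y; the sign change of
  y exchanges the two.\<close>

lemma L3_mult8_half:
  assumes "m mod 8 = 3"
  shows "rr2 (8 * m) = 2 * num_reps (8 * m) L3"
proof -
  have "rr1 m = reps111 (\<lambda>(x, y, z). 4 dvd x - y) m + reps111 (\<lambda>(x, y, z). \<not> 4 dvd x - y) m"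
    using reps_split[of 1 1 1 "\<lambda>_. True" m "\<lambda>(x, y, z). 4 dvd x - y"]
    by (simp add: rr1_eq case_prod_unfold)
  also have "reps111 (\<lambda>(x, y, z). \<not> 4 dvd x - y) m = reps111 (\<lambda>(x, y, z). 4 dvd x + y) m"
  proof (rule reps_cong, unfold prod.case)
    fix x y z assume "diag_form 1 1 1 (x, y, z) = m"
    then have "odd x \<and> odd y" using diag_form_111_all_odd[OF _ assms] by blast
    then show "\<not> 4 dvd x - y \<longleftrightarrow> 4 dvd x + y" using four_dvd_add_iff_odd by blast
  qed
  also have "\<dots> = reps111 (\<lambda>(x, y, z). 4 dvd x - y) m"
    by (rule reps_reindex[where h = "\<lambda>(x, y, z). (x, - y, z)"])
       (auto simp: inj_def diag_form_def intro: exI[of _ "- _"])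
  finally show ?thesis by (simp add: rr2_mult8 L3_mult8)
qed

lemma L3_mult8_zero:
  assumes "m mod 8 = 5 \<or> m mod 8 = 7"
  shows "num_reps (8 * m) L3 = 0"
  unfolding L3_mult8
proof (rule reps_eq_0, unfold prod.case)
  fix x y z assume "diag_form 1 1 1 (x, y, z) = m"
  then have "(even x \<longleftrightarrow> odd y) \<or> even x \<and> even y \<and> (4 dvd x \<longleftrightarrow> \<not> 4 dvd y)"
    using assms by - (erule square_classes_8_cases, unfold square_class_8_def, elim disjE conjE; simp)
  then show "\<not> 4 dvd x - y" using four_dvd_diff_iff_even four_dvd_diff_parity by blast
qed

text \<open>Again 6 = 3 times 2; now the 2 is the choice of which of x, y is even when x^2 + y^2 +
  2z^2 is odd.\<close>

lemma L3_mult16: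
  assumes "odd m"
  shows "rr2 (16 * m) = 6 * num_reps (16 * m) L3"
proof -
  have "rr2 (16 * m) = reps111 (\<lambda>_. True) (2 * m)"
    using rr2_mult8[of "2 * m"] by (simp add: rr1_eq)
  also have "\<dots> = 3 * reps112 (\<lambda>_. True) m"
    using reps111_double_odd_third[OF assms] by (simp add: reps112_eq_reps111)
  also have "reps112 (\<lambda>_. True) m = 2 * reps112 (\<lambda>(x, y, z). even y) m"
  proof (rule reps112_half)
    fix x y z :: int assume "diag_form 1 1 2 (x, y, z) = m"
    then have "x\<^sup>2 + y\<^sup>2 + 2 * z\<^sup>2 = m" by (simp add: diag_form_def)
    then have "odd (x\<^sup>2 + y\<^sup>2 + 2 * z\<^sup>2)" using assms by simp
    then show "even x \<noteq> even y" by simp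
  qed
  finally show ?thesis by (simp add: num_reps_L3 reps112_mult16)
qed

lemma L3_mult32: "num_reps (32 * m) L3 = reps111 (\<lambda>(x, y, z). even (x - y)) m"
  using reps112_mult16[of "2 * m"] reps112_mult2[of "\<lambda>x y z. even y" m] by (simp add: num_reps_L3)

lemma rr2_mult32: "rr2 (32 * m) = rr1 m"
  using rr2_mult8[of "4 * m"] by (simp add: rr1_eq reps111_mult4)

lemma L3_mult32_third:
  assumes "m mod 8 = 1 \<or> m mod 8 = 5"
  shows "rr2 (32 * m) = 3 * num_reps (32 * m) L3"
proof -
  have "rr1 m = 3 * reps111 (\<lambda>(x, y, z). odd z) m"
    unfolding rr1_eq by (rule reps111_third) (use exactly_one_odd[OF _ assms] in blast)
  moreover have "reps111 (\<lambda>(x, y, z). even (x - y)) m = reps111 (\<lambda>(x, y, z). odd z) m"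
  proof (rule reps_cong, unfold prod.case)
    fix x y z assume "diag_form 1 1 1 (x, y, z) = m"
    then show "even (x - y) \<longleftrightarrow> odd z" using exactly_one_odd[OF _ assms, of x y z] by auto
  qed
  ultimately show ?thesis by (simp add: rr2_mult32 L3_mult32)
qed

lemma L3_mult32_all:
  assumes "m mod 8 = 3"
  shows "rr2 (32 * m) = num_reps (32 * m) L3"
  unfolding rr2_mult32 L3_mult32 rr1_eq
  by (rule reps_cong) (use diag_form_111_all_odd[OF _ assms] in auto)

lemma L3_mult32_zero:
  assumes "m mod 8 = 7"
  shows "num_reps (32 * m) L3 = 0"
  unfolding L3_mult32
proof (rule reps_eq_0)
  fix x y z assume "diag_form 1 1 1 (x, y, z) = m"
  then have False using assms by - (erule square_classes_8_cases, unfold square_class_8_def, elim disjE conjE; simp)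
  then show "\<not> (\<lambda>(x, y, z). even (x - y)) (x, y, z)" ..
qed

lemma L3_mult64:
  assumes "odd m"
  shows "rr2 (64 * m) = 3 * num_reps (64 * m) L3"
proof -
  have *: "(2 * m) mod 8 = 2 \<or> (2 * m) mod 8 = 6" using assms by presburger
  have "num_reps (64 * m) L3 = reps111 (\<lambda>(x, y, z). even (x - y)) (2 * m)"
    using L3_mult32[of "2 * m"] by simp
  also have "\<dots> = reps111 (\<lambda>(x, y, z). even z) (2 * m)"
  proof (rule reps_cong, unfold prod.case)
    fix x y z assume "diag_form 1 1 1 (x, y, z) = 2 * m"
    then show "even (x - y) \<longleftrightarrow> even z" using exactly_one_even[OF _ *, of x y z] by auto
  qed
  finally show ?thesis
    using rr2_mult32[of "2 * m"] reps111_double_odd_third[OF assms] by (simp add: rr1_eq)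
qed

lemma L3_mult128: "rr2 (128 * m) = num_reps (128 * m) L3"
proof -
  have "reps111 (\<lambda>(x, y, z). even (x - y)) (4 * m) = rr1 (4 * m)"
    unfolding rr1_eq by (rule reps_cong) (use diag_form_111_mult4_even[of _ _ _ m] in auto)
  then show ?thesis using L3_mult32[of "4 * m"] rr2_mult32[of "4 * m"] by simp
qed

section \<open>The case of residue 1 modulo 8\<close>

lemma odd_square_fiber:
  assumes "odd n" "k = n\<^sup>2"
  shows "{x. x \<in> odds \<and> x\<^sup>2 = k} = {n, - n}"
  using assms by (auto simp: power2_eq_iff)

lemma chi4_minus: "odd n \<Longrightarrow> chi4 (- n) = - chi4 n"
proof -
  assume "odd n"
  then have "(- n) mod 4 = 1 \<longleftrightarrow> n mod 4 \<noteq> 1" by presburger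
  then show ?thesis by (simp add: chi4_def)
qed

text \<open>The factor 2 arises because n and -n contribute equally, \<open>chi4\<close> being odd
  on odd integers.\<close>

lemma theta_T_nth_square:
  assumes "odd n" "int N = n\<^sup>2"
  shows "fps_nth theta_T N = 2 * (chi4 n * n)"
  unfolding theta_T_def gen_series_nth odd_square_fiber[OF assms]
  using assms(1) by (subst sum.insert) (auto simp: chi4_minus)

lemma theta_T_nth_nonsquare:
  assumes "\<nexists>n. int N = n\<^sup>2"
  shows "fps_nth theta_T N = 0"
proof -
  have empty: "{x. x \<in> odds \<and> x\<^sup>2 = int N} = {}"
    by (rule equals0I) (use assms in \<open>auto dest: sym\<close>)
  show ?thesis unfolding theta_T_def gen_series_nth empty by simp
qed

lemma sum_signed_indicator:
  assumes "finite S"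
  shows "(\<Sum>v\<in>S. if Q v then 1 else - 1 :: int) = 2 * int (card {v \<in> S. Q v}) - int (card S)"
proof -
  have "S \<inter> - {v. Q v} = S - {v \<in> S. Q v}" "S \<inter> {v. Q v} = {v \<in> S. Q v}" by auto
  moreover have "card (S - {v \<in> S. Q v}) = card S - card {v \<in> S. Q v}"
    using assms by (intro card_Diff_subset) auto
  moreover have "card {v \<in> S. Q v} \<le> card S" using assms by (auto intro: card_mono)
  ultimately show ?thesis using assms by (simp add: sum.If_cases of_nat_diff)
qed

lemma theta_triple_expand:
  assumes "b > 0" "c > 0"
  shows "fps_nth (gen_series odds (\<lambda>n. n\<^sup>2) w * gen_series UNIV (\<lambda>n. b * n\<^sup>2) w1 * gen_series UNIV (\<lambda>n. c * n\<^sup>2) w2) N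
    = (\<Sum>(x, u, v) | diag_form 1 b c (x, u, v) = int N \<and> odd x. w x * w1 u * w2 v)"
proof -
  have "fps_nth (gen_series odds (\<lambda>n. n\<^sup>2) w * gen_series UNIV (\<lambda>n. b * n\<^sup>2) w1 * gen_series UNIV (\<lambda>n. c * n\<^sup>2) w2) N
    = (\<Sum>p | p \<in> (odds \<times> UNIV) \<times> UNIV \<and> (case p of (xu, v) \<Rightarrow> (case xu of (x, u) \<Rightarrow> x\<^sup>2 + b * u\<^sup>2) + c * v\<^sup>2) = int N.
        case p of (xu, v) \<Rightarrow> (case xu of (x, u) \<Rightarrow> w x * w1 u) * w2 v)"
    using assms by (simp add: gen_series_mult graded_intros gen_series_nth)
  also have "\<dots> = (\<Sum>(x, u, v) | diag_form 1 b c (x, u, v) = int N \<and> odd x. w x * w1 u * w2 v)"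
    by (rule sum.reindex_bij_witness[where j = "\<lambda>((x, u), v). (x, u, v)" and i = "\<lambda>(x, u, v). ((x, u), v)"])
       (auto simp: diag_form_def)
  finally show ?thesis .
qed

lemma sum_signs_reps:
  assumes "b > 0" "c > 0"
  shows "(\<Sum>(x, u, v) | diag_form 1 b c (x, u, v) = k \<and> odd x. if Q u v then 1 else - 1)
    = 2 * int (reps (diag_form 1 b c) (\<lambda>(x, u, v). odd x \<and> Q u v) k)
      - int (reps (diag_form 1 b c) (\<lambda>(x, u, v). odd x) k)"
proof -
  let ?S = "{(x, u, v). diag_form 1 b c (x, u, v) = k \<and> odd x}"
  have "?S = {p. diag_form 1 b c p = k \<and> (case p of (x, u, v) \<Rightarrow> odd x)}" by auto
  then have "finite ?S" using assms by (simp add: finite_diag_form)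
  from sum_signed_indicator[OF this, of "\<lambda>(x, u, v). Q u v"]
  show ?thesis unfolding reps_def case_prod_unfold by (simp add: conj_assoc)
qed

text \<open>The classical (2/x) = (-1)^((x^2 - 1)/8); the parity of the exponent depends only on x
  modulo 8.\<close>

lemma chi8_eq_alt:
  assumes "odd x"
  shows "chi8 x = alt ((x\<^sup>2 - 1) div 8)"
proof -
  define q where "q = x div 8"
  define r where "r = x mod 8"
  have x: "x = 8 * q + r" by (simp add: q_def r_def)
  have "r = 1 \<or> r = 3 \<or> r = 5 \<or> r = 7" using assms unfolding r_def odd_mod_8 .
  moreover have "x\<^sup>2 - 1 = 8 * (2 * (4 * q\<^sup>2 + q * r)) + (r\<^sup>2 - 1)" 
    unfolding x by (simp add: power2_eq_square algebra_simps)
  then have "(x\<^sup>2 - 1) div 8 = 2 * (4 * q\<^sup>2 + q * r) + (r\<^sup>2 - 1) div 8" 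
    by (simp only: div_mult_self4[of 8 _ "_::int", simplified])
  then have "alt ((x\<^sup>2 - 1) div 8) = alt ((r\<^sup>2 - 1) div 8)" by (simp add: alt_def)
  ultimately show ?thesis unfolding chi8_def r_def[symmetric] by (elim disjE) (simp_all add: alt_def)
qed

text \<open>Since x^2 = N - 8u^2 - 8v^2, the sign chi8(x) is a constant times alt(u) alt(v). This
  turns P' F F into P F' F', which is T.\<close>

lemma P'FF_nth:
  "fps_nth (theta_P' * theta_F * theta_F) N = alt ((int N - 1) div 8) * fps_nth theta_T N"
proof -
  have "chi8 x = alt ((int N - 1) div 8) * (alt u * alt v)"
    if "odd x" and s: "x\<^sup>2 + 8 * u\<^sup>2 + 8 * v\<^sup>2 = int N" for x u v
  proof -
    have "x\<^sup>2 - 1 = (int N - 1) + 8 * (- (u\<^sup>2) - v\<^sup>2)" using s by simp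
    then have "(x\<^sup>2 - 1) div 8 = (int N - 1) div 8 + (- (u\<^sup>2) - v\<^sup>2)"
      by (simp only: div_mult_self2)
    also have "alt \<dots> = alt ((int N - 1) div 8) * (alt u * alt v)"
      by (simp add: alt_def)
    finally show ?thesis using chi8_eq_alt[OF \<open>odd x\<close>] by simp
  qed
  then show ?thesis
    unfolding T_eq theta_P'_def theta_P_def theta_F_def theta_F'_def
    by (auto simp: theta_triple_expand sum_distrib_left diag_form_def intro!: sum.cong)
qed

text \<open>From 8u^2 + 8v^2 = (2(u + v))^2 + (2(u - v))^2; the divisibility conditions make u and v
  integral.\<close>

lemma reps_1_8_8:
  "reps (diag_form 1 8 8) P k = reps111 (\<lambda>(x, y, z). even y \<and> even z \<and> 4 dvd y - z \<and> P (x, (y + z) div 4, (y - z) div 4)) k"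
proof (rule reps_reindex[where h = "\<lambda>(x, u, v). (x, 2 * (u + v), 2 * (u - v))", symmetric])
  fix x y z :: int
  assume P: "(\<lambda>(x, y, z). even y \<and> even z \<and> 4 dvd y - z \<and> P (x, (y + z) div 4, (y - z) div 4)) (x, y, z)"
    and s: "diag_form 1 1 1 (x, y, z) = k"
  obtain v where v: "y - z = 4 * v" using P by (auto elim: dvdE)
  obtain z' where z': "z = 2 * z'" using P by (auto elim: evenE)
  define u where "u = z' + v"
  have yz: "y = 2 * (u + v)" "z = 2 * (u - v)" using v z' by (auto simp: u_def)
  show "\<exists>x' y' z'. (case (x', y', z') of (x, u, v) \<Rightarrow> (x, 2 * (u + v), 2 * (u - v))) = (x, y, z) \<and>
      diag_form 1 8 8 (x', y', z') = k \<and> P (x', y', z')"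
    using P s unfolding yz
    by (intro exI[of _ x] exI[of _ u] exI[of _ v]) (auto simp: diag_form_def power2_eq_square algebra_simps)
qed (auto simp: inj_def diag_form_def power2_eq_square algebra_simps)

text \<open>The coefficient of P F'^2 counts solutions with u + v even minus those with u + v odd.
  As y = 2(u + v), the even ones are those of L4, and all solutions together are r1/3 in
  number.\<close>

lemma L4_theta:
  assumes "int N mod 8 = 1"
  shows "3 * fps_nth theta_T N = 6 * int (num_reps (int N) L4) - int (rr1 (int N))"
proof -
  have "fps_nth theta_T N = (\<Sum>(x, u, v) | diag_form 1 8 8 (x, u, v) = int N \<and> odd x. if even (u + v) then 1 else - 1)"
    unfolding T_eq theta_P_def theta_F'_def
    by (auto simp: theta_triple_expand alt_def intro!: sum.cong)
  also have "\<dots> = 2 * int (reps (diag_form 1 8 8) (\<lambda>(x, u, v). odd x \<and> even (u + v)) (int N))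
      - int (reps (diag_form 1 8 8) (\<lambda>(x, u, v). odd x) (int N))"
    by (rule sum_signs_reps) simp_all
  also have "reps (diag_form 1 8 8) (\<lambda>(x, u, v). odd x) (int N) = reps111 (\<lambda>(x, y, z). odd x) (int N)"
    unfolding reps_1_8_8
  proof (rule reps_cong, unfold prod.case)
    fix x y z assume "diag_form 1 1 1 (x, y, z) = int N"
    then have "odd x \<Longrightarrow> even y \<and> even z \<and> (4 dvd y \<longleftrightarrow> 4 dvd z)" using assms by - (erule square_classes_8_cases, unfold square_class_8_def, elim disjE conjE; simp)
    then show "even y \<and> even z \<and> 4 dvd y - z \<and> odd x \<longleftrightarrow> odd x" using four_dvd_diff_iff_even by blast
  qed
  also have "reps (diag_form 1 8 8) (\<lambda>(x, u, v). odd x \<and> even (u + v)) (int N) = num_reps (int N) L4"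
    unfolding reps_1_8_8 num_reps_L4
  proof (rule reps_cong, unfold prod.case)
    fix x y z assume "diag_form 1 1 1 (x, y, z) = int N"
    then have "4 dvd y \<and> 4 dvd z \<Longrightarrow> odd x" using assms by - (erule square_classes_8_cases, unfold square_class_8_def, elim disjE conjE; simp)
    moreover have "even ((y + z) div 4 + (y - z) div 4) \<longleftrightarrow> 4 dvd y" if "even y" "4 dvd y - z"
    proof -
      obtain p where p: "y = 2 * p" using \<open>even y\<close> by (rule evenE)
      obtain q where q: "y - z = 4 * q" using \<open>4 dvd y - z\<close> by (rule dvdE)
      have "y + z = 4 * (p - q)" using p q by simp
      then show ?thesis unfolding q \<open>y + z = _\<close> unfolding p four_dvd_double by simp
    qed
    moreover have "even y" if "4 dvd y" for y :: int using that by presburger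
    ultimately show "even y \<and> even z \<and> 4 dvd y - z \<and> odd x \<and> even ((y + z) div 4 + (y - z) div 4)
        \<longleftrightarrow> 4 dvd y \<and> 4 dvd z" using four_dvd_diff_iff_even[of y z] by blast
  qed
  finally have "fps_nth theta_T N = 2 * int (num_reps (int N) L4) - int (reps111 (\<lambda>(x, y, z). odd x) (int N))" .
  moreover have "rr1 (int N) = 3 * reps111 (\<lambda>(x, y, z). odd z) (int N)"
    and "reps111 (\<lambda>(x, y, z). odd x) (int N) = reps111 (\<lambda>(x, y, z). odd z) (int N)"
    unfolding rr1_eq by (rule reps111_third; use exactly_one_odd[of _ _ _ "int N"] assms in blast)+
  ultimately show ?thesis by simp
qed

lemma reps_1_16_8:
  "reps (diag_form 1 16 8) (\<lambda>(x, u, v). P x u v) k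
    = reps112 (\<lambda>(x, y, z). 4 dvd y \<and> even z \<and> P x (y div 4) (z div 2)) k"
  by (rule reps_reindex[where h = "\<lambda>(x, u, v). (x, 4 * u, 2 * v)", symmetric])
     (auto simp: inj_def diag_form_def power_mult_distrib elim!: dvdE)

text \<open>Writing P' F F as P H' F by \<open>P'F_eq\<close> moves the sign to u alone in x^2 +
  16u^2 + 8v^2. With y = 4u, u even means 8 | y, which is L3; all solutions together number
  r2/2.\<close>

lemma L3_theta:
  assumes "int N mod 8 = 1"
  shows "2 * (alt ((int N - 1) div 8) * fps_nth theta_T N) = 4 * int (num_reps (int N) L3) - int (rr2 (int N))"
proof -
  have "alt ((int N - 1) div 8) * fps_nth theta_T N = fps_nth (theta_P * theta_H' * theta_F) N"
    unfolding P'FF_nth[symmetric] P'F_eq ..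
  also have "\<dots> = (\<Sum>(x, u, v) | diag_form 1 16 8 (x, u, v) = int N \<and> odd x. if even u then 1 else - 1)"
    unfolding theta_P_def theta_H'_def theta_F_def
    by (auto simp: theta_triple_expand alt_def intro!: sum.cong)
  also have "\<dots> = 2 * int (reps (diag_form 1 16 8) (\<lambda>(x, u, v). odd x \<and> even u) (int N))
      - int (reps (diag_form 1 16 8) (\<lambda>(x, u, v). odd x) (int N))"
    by (rule sum_signs_reps) simp_all
  also have "reps (diag_form 1 16 8) (\<lambda>(x, u, v). odd x) (int N) = reps112 (\<lambda>(x, y, z). odd x) (int N)"
    unfolding reps_1_16_8
  proof (rule reps_cong, unfold prod.case)
    fix x y z assume "diag_form 1 1 2 (x, y, z) = int N"
    then have "odd x \<Longrightarrow> 4 dvd y \<and> even z" using assms by - (erule square_classes_8_cases, unfold square_class_8_def, elim disjE conjE; simp)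
    then show "4 dvd y \<and> even z \<and> odd x \<longleftrightarrow> odd x" by blast
  qed
  also have "\<dots> = reps112 (\<lambda>(x, y, z). odd y) (int N)" by (rule reps112_swap12)
  also have "reps (diag_form 1 16 8) (\<lambda>(x, u, v). odd x \<and> even u) (int N) = num_reps (int N) L3"
    unfolding reps_1_16_8 num_reps_L3
  proof (rule reps_cong, unfold prod.case)
    fix x y z assume "diag_form 1 1 2 (x, y, z) = int N"
    then have "4 dvd y \<Longrightarrow> odd x" using assms by - (erule square_classes_8_cases, unfold square_class_8_def, elim disjE conjE; simp)
    moreover have "8 dvd y \<longleftrightarrow> 4 dvd y \<and> even (y div 4)" by presburger
    ultimately show "4 dvd y \<and> even z \<and> odd x \<and> even (y div 4) \<longleftrightarrow> 8 dvd y \<and> even z" by blast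
  qed
  finally have "alt ((int N - 1) div 8) * fps_nth theta_T N
    = 2 * int (num_reps (int N) L3) - int (reps112 (\<lambda>(x, y, z). odd y) (int N))" .
  moreover have "rr2 (int N) = 2 * reps112 (\<lambda>(x, y, z). odd y) (int N)"
    unfolding rr2_eq
  proof (rule reps112_half)
    fix x y z :: int assume "diag_form 1 1 2 (x, y, z) = int N"
    then show "odd x \<noteq> odd y" using assms by - (erule square_classes_8_cases, unfold square_class_8_def, elim disjE conjE; simp)
  qed
  ultimately show ?thesis by simp
qed

lemma minus_one_powi: "(- 1 :: real) powi m = of_int (alt m)"
  by (simp add: power_int_minus_left alt_def)

lemma theta_T_nth:
  assumes "odd N"
  shows "real_of_int (fps_nth theta_T N) = 2 * (delta_square (int N) * sqrt_sign (int N) * sqrt (int N))"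
proof (cases "\<exists>n. int N = n\<^sup>2")
  case True
  then obtain m where m: "int N = m\<^sup>2" by blast
  \<comment> \<open>The positive root is the value of \<open>sqrt\<close>; at it, (n - 1)/2 is even
    exactly when chi4(n) = 1.\<close>
  define n where "n = \<bar>m\<bar>"
  have n: "int N = n\<^sup>2" "n \<ge> 0" using m by (simp_all add: n_def)
  have "odd (int N)" using assms by simp
  then have "odd n" unfolding n(1) by simp
  have "real N = (real_of_int n)\<^sup>2" by (metis n(1) of_int_of_nat_eq of_int_power)
  then have sqrt: "sqrt (int N) = real_of_int n" using n(2) by simp
  have "(sqrt (int N) - 1) / 2 = real_of_int (n - 1) / real_of_int 2" unfolding sqrt by simp
  then have "\<lfloor>(sqrt (int N) - 1) / 2\<rfloor> = (n - 1) div 2" by (simp only: floor_divide_of_int_eq)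
  moreover have "even ((n - 1) div 2) \<longleftrightarrow> n mod 4 = 1" using \<open>odd n\<close> by presburger
  ultimately have "sqrt_sign (int N) = of_int (chi4 n)"
    by (simp add: sqrt_sign_def minus_one_powi alt_def chi4_def)
  moreover have "delta_square (int N) = 1" using True by (simp add: delta_square_def)
  ultimately show ?thesis using sqrt theta_T_nth_square[OF \<open>odd n\<close> n(1)] by simp
next
  case False
  then show ?thesis by (simp add: delta_square_def theta_T_nth_nonsquare)
qed

text \<open>The coefficient of \<open>theta_T\<close> is twice the correction term (without its sign
  in the L3 case), so solving \<open>L4_theta\<close> and \<open>L3_theta\<close> for the
  representation numbers suffices.\<close>

lemma squares_correction:
  fixes k :: int
  assumes "k \<ge> 0" "k mod 8 = 1"
  shows "real (num_reps k L4) = 1/6 * real (rr1 k) + delta_square k * sqrt_sign k * sqrt (real_of_int k)"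
    and "real (num_reps k L3) = 1/4 * real (rr2 k)
      + delta_square k * sqrt_sign k * (-1) powi ((k - 1) div 8) * sqrt (real_of_int k)"
proof -
  obtain N where N: "k = int N" using assms(1) by (metis nonneg_int_cases)
  have "odd N" using assms(2) unfolding N by presburger
  note T = theta_T_nth[OF this]
  show "real (num_reps k L4) = 1/6 * real (rr1 k) + delta_square k * sqrt_sign k * sqrt (real_of_int k)"
    using arg_cong[OF L4_theta[of N], of real_of_int] assms(2) T unfolding N by simp
  have "real_of_int (2 * (alt ((int N - 1) div 8) * fps_nth theta_T N))
      = real_of_int (4 * int (num_reps (int N) L3) - int (rr2 (int N)))"
    using L3_theta[of N] assms(2) unfolding N by simp
  then show "real (num_reps k L3) = 1/4 * real (rr2 k)
      + delta_square k * sqrt_sign k * (-1) powi ((k - 1) div 8) * sqrt (real_of_int k)"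
    using T unfolding N minus_one_powi by (simp add: field_simps)
qed

section \<open>Assembly by the power of 2 in k\<close>

lemma L1_L2_L4_generic:
  fixes a \<alpha> t :: nat
  assumes \<alpha>: "\<alpha> \<in> {1, 3, 5, 7}" and k: "k = 2 ^ a * (8 * int t + int \<alpha>)" and "(a, \<alpha>) \<noteq> (0, 1)"
  shows "real (num_reps k L1) = c1 a \<alpha> * real (rr1 k)"
    and "real (num_reps k L2) = c2 a \<alpha> * real (rr1 k)"
    and "real (num_reps k L4) = c4 a \<alpha> * real (rr1 k)"
proof -
  \<comment> \<open>For a \<le> 1 the residue of k modulo 8 is determined by a and \<alpha>, for a =
    2, 3 that modulo 16; from a = 4 on, 16 divides k.\<close>
  consider "a = 0" | "a = 1" | "a = 2" | "a = 3" | "a \<ge> 4" by linarith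
  then have "real (num_reps k L1) = c1 a \<alpha> * real (rr1 k)
    \<and> real (num_reps k L2) = c2 a \<alpha> * real (rr1 k) \<and> real (num_reps k L4) = c4 a \<alpha> * real (rr1 k)"
  proof cases
    case 1
    then have "k mod 8 = int \<alpha>" using \<alpha> k by auto
    with 1 \<alpha> assms(3) L1_zero[of k] L2_zero[of k] L4_zero[of k] L1_third[of k] L1_eq_double_L2[of k]
    show ?thesis by (auto simp: c1_def c2_def c4_def)
  next
    case 2
    then have "k = 8 * (2 * int t) + 2 * int \<alpha>" using k by simp
    then have "k mod 8 = (2 * int \<alpha>) mod 8" by (simp only: mod_mult_self4)
    with 2 \<alpha> L1_zero[of k] L2_zero[of k] L4_zero[of k] L1_third[of k]
    show ?thesis by (auto simp: c1_def c2_def c4_def)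
  next
    case 3
    then have "k = 16 * (2 * int t) + 4 * int \<alpha>" using k by simp
    then have "k mod 16 = (4 * int \<alpha>) mod 16" by (simp only: mod_mult_self4)
    then have "k mod 16 = (if \<alpha> \<in> {1, 5} then 4 else 12)" using \<alpha> by auto
    with 3 \<alpha> L1_zero[of k] L2_zero[of k] L4_zero[of k] L1_two_thirds[of k] L2_eq_L1[of k] L4_third[of k]
    show ?thesis by (auto simp: c1_def c2_def c4_def)
  next
    case 4
    then have "k = 16 * (4 * int t) + 8 * int \<alpha>" using k by simp
    then have "k mod 16 = (8 * int \<alpha>) mod 16" by (simp only: mod_mult_self4)
    then have "k mod 16 = 8" using \<alpha> by auto
    with 4 L4_zero[of k] L1_third[of k] L2_eq_L1[of k]
    show ?thesis by (auto simp: c1_def c2_def c4_def)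
  next
    case 5
    then have "(2 :: int) ^ a = 16 * 2 ^ (a - 4)" using power_add[of "2 :: int" 4 "a - 4"] by simp
    then have "k mod 16 = 0" unfolding k by simp
    with 5 mod_16_0[of k] show ?thesis by (simp add: c1_def c2_def c4_def)
  qed
  then show "real (num_reps k L1) = c1 a \<alpha> * real (rr1 k)"
    "real (num_reps k L2) = c2 a \<alpha> * real (rr1 k)" "real (num_reps k L4) = c4 a \<alpha> * real (rr1 k)"
    by blast+
qed

lemma L3_generic:
  fixes a \<alpha> t :: nat
  assumes \<alpha>: "\<alpha> \<in> {1, 3, 5, 7}" and k: "k = 2 ^ a * (8 * int t + int \<alpha>)" and "(a, \<alpha>) \<noteq> (0, 1)"
  shows "real (num_reps k L3) = c3 a \<alpha> * real (rr2 k)"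
proof -
  define m where "m = 8 * int t + int \<alpha>"
  have k: "k = 2 ^ a * m" using k by (simp add: m_def)
  have m8: "m mod 8 = int \<alpha>" using \<alpha> by (auto simp: m_def)
  have "odd m" using \<alpha> by (auto simp: m_def)
  consider "a = 0" | "a = 1" | "a = 2" | "a = 3" | "a = 4" | "a = 5" | "a = 6" | "a \<ge> 7" by linarith
  then show ?thesis
  proof cases
    case 1
    then show ?thesis using k m8 \<alpha> assms(3) L3_zero[of k] by (auto simp: c3_def)
  next
    case 2
    then have "k mod 8 = 2 \<or> k mod 8 = 6" using k \<open>odd m\<close> by simp presburger
    then show ?thesis using 2 L3_zero[of k] by (auto simp: c3_def)
  next
    case 3
    then show ?thesis using k m8 \<alpha> L3_mult4[of m] L3_mult4_zero[of m] by (auto simp: c3_def)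
  next
    case 4
    then show ?thesis using k m8 \<alpha> L3_mult8_third[of m] L3_mult8_half[of m] L3_mult8_zero[of m]
      by (auto simp: c3_def)
  next
    case 5
    then show ?thesis using k L3_mult16[OF \<open>odd m\<close>] by (simp add: c3_def)
  next
    case 6
    then show ?thesis using k m8 \<alpha> L3_mult32_third[of m] L3_mult32_all[of m] L3_mult32_zero[of m]
      by (auto simp: c3_def)
  next
    case 7
    then show ?thesis using k L3_mult64[OF \<open>odd m\<close>] by (simp add: c3_def)
  next
    case 8
    then have "(2 :: int) ^ a = 128 * 2 ^ (a - 7)" using power_add[of "2 :: int" 7 "a - 7"] by simp
    then have "k = 128 * (2 ^ (a - 7) * m)" using k by simp
    then show ?thesis using 8 L3_mult128 by (simp add: c3_def)
  qed
qed

theorem theorem2p4: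
  fixes k :: int and a t \<alpha> :: nat
  assumes "\<alpha> \<in> {1, 3, 5, 7}"
    and "k = 2 ^ a * (8 * int t + int \<alpha>)"
  shows
    "(real (num_reps k L1) =
      (if (a, \<alpha>) = (0, 1)
       then 1/3 * real (rr1 k)
            + delta_square k * sqrt_sign k * (2 * sqrt (real_of_int k))
       else c1 a \<alpha> * real (rr1 k))) \<and>
     (real (num_reps k L2) =
      (if (a, \<alpha>) = (0, 1)
       then 1/6 * real (rr1 k)
            + delta_square k * sqrt_sign k * sqrt (real_of_int k)
       else c2 a \<alpha> * real (rr1 k))) \<and>
     (real (num_reps k L3) =
      (if (a, \<alpha>) = (0, 1)
       then 1/4 * real (rr2 k)
            + delta_square k * sqrt_sign k * (-1) powi ((k - 1) div 8) * sqrt (real_of_int k)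
       else c3 a \<alpha> * real (rr2 k))) \<and>
     (real (num_reps k L4) =
      (if (a, \<alpha>) = (0, 1)
       then 1/6 * real (rr1 k)
            + delta_square k * sqrt_sign k * sqrt (real_of_int k)
       else c4 a \<alpha> * real (rr1 k)))"
proof (cases "(a, \<alpha>) = (0, 1)")
  case True
  then have k: "k \<ge> 0" "k mod 8 = 1" using assms by auto
  \<comment> \<open>Congruences reduce L1 and L2 to L4, so the L1 correction is twice that of
    L4.\<close>
  have "num_reps k L1 = 2 * num_reps k L4" "num_reps k L2 = num_reps k L4"
    using k(2) by (simp_all add: L1_eq_double_L2 L4_eq_L2)
  then show ?thesis using True squares_correction[OF k] by simp
next
  case False
  then show ?thesis using L1_L2_L4_generic[OF assms False] L3_generic[OF assms False]
    by (simp only: False if_False simp_thms)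
qed

end
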